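(* If $\mathfrak g$ is a local Lie algebra, then $V(\mathfrak g)$ is the universal associative unital vertex algebra over $\mathfrak g$, i.e. it is an initial object of the category of associative unital vertex algebras over $\mathfrak g$.
   Context: Conventions: $\mathbb K$ is a field of characteristic $0$. All vector spaces are super ($\mathbb Z/2$-graded), multiplications and morphisms are even, commutators are supercommutators, $\zeta^{ab}=(-1)^{p(a)p(b)}$; Lie algebra means Lie superalgebra; subsets contain the even and odd components of their elements. $x^{(n)}=x^n/n!$. Distributions: $\mathfrak g[[z^\pm]]$ is the space of formal sums $a(z)=\sum_{t\in\mathbb Z}a_tz^{-t-1}$, $a_t\in\mathfrak g$; $\mathrm{res}_za(z)=a_0$. For a Lie algebra $\mathfrak g$ put $[a(w)_\lambda b(w)]=\mathrm{res}_z e^{(z-w)\lambda}[a(z),b(w)]=\sum_{t\ge0}a(w)_tb(w)\lambda^{(t)}$. For $F\subset\mathfrak g[[z^\pm]]$, $\bar F$ is the smallest subspace containing $F$ and closed under $\partial_z$ and all products $a(z)_tb(z)$, $t\ge0$. A set of distributions is local if for any two elements there is $n\ge0$ with $(z-w)^n[a(z),b(w)]=0$. A local Lie algebra is a Lie algebra $\mathfrak g$ with an even derivation $T$ and a local subset $F_{\mathfrak g}\subset\mathfrak g[[z^\pm]]$ such that $Ta(z)=\partial_za(z)$ (coefficientwise) for $a(z)\in F_{\mathfrak g}$ and $\mathfrak g=\mathrm{span}\{a_t\mid a(z)\in F_{\mathfrak g},t\in\mathbb Z\}$. A vertex algebra is a (not necessarily associative) algebra $V$ with an even derivation $T$ and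 an even linear map $V\otimes V\to V[\lambda]$, $[a_\lambda b]=\sum_{t\ge0}a_tb\lambda^{(t)}$, with $T[a_\lambda b]=[Ta_\lambda b]+[a_\lambda Tb]$ and $[Ta_\lambda b]=-\lambda[a_\lambda b]$. Put $a_{-1-t}b=(T^{(t)}a)b$ for $t\ge0$, and $Y(a)=\sum_{t\in\mathbb Z}a_tz^{-t-1}\in\mathrm{End}(V)[[z^\pm]]$. It is unital if the algebra has an identity $1$; morphisms (of unital vertex algebras) are even linear maps preserving $T$, the product, the $\lambda$-bracket (and $1$). It is associative if: (1) $[a,b]c=a(bc)-\zeta^{ab}b(ac)$ where $[a,b]=ab-\zeta^{ab}ba$; (2) $[[a_\lambda b]_\mu c]=[a_\lambda[b_{\mu-\lambda}c]]-\zeta^{ab}[b_{\mu-\lambda}[a_\lambda c]]$; (3) $[a_\lambda b]=-\zeta^{ab}[b_{-\lambda-T}a]$ where $[b_{-\lambda-T}a]=\sum_t(-\lambda-T)^{(t)}(b_ta)$; (4) $[a,b]=\sum_{i\ge0}(-1)^iT^{(i+1)}(a_ib)$; (5) $[a_\lambda bc]=[a_\lambda b]c+\zeta^{ab}b[a_\lambda c]+\int_0^\lambda d\mu\,[[a_\lambda b]_\mu c]$. A vertex algebra over a local Lie algebra $\mathfrak g$ is a vertex algebra $V$ together with a $\mathfrak g$-module structure $\rho:\mathfrak g\to\mathfrak{gl}(V)$ such that $\rho F_{\mathfrak g}\subset Y(V)$, where $\rho a(z)=\sum\rho(a_t)z^{-t-1}$. A morphism of (associative unital) vertex algebras over $\mathfrak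 g$ is a morphism of (unital) vertex algebras that is also a $\mathfrak g$-module morphism. $V(\mathfrak g)$: let $\bar{\mathfrak g}_+=\mathrm{span}\{a_t\mid a(z)\in\bar F_{\mathfrak g},t\ge0\}$, which is a Lie subalgebra of $\mathfrak g$, and let $V(\mathfrak g)=U(\mathfrak g)\otimes_{U(\bar{\mathfrak g}_+)}\mathbb K$ with $\mathbb K$ the trivial $\bar{\mathfrak g}_+$-module, and $1:=1\otimes1$. The $\mathfrak g$-module $V(\mathfrak g)$ has a unique structure of an associative vertex algebra over $\mathfrak g$ with identity $1$, with which it is endowed. *)

theory Defs
  imports
    "HOL-Algebra.Algebra"
    "HOL-Algebra.Algebraic_Closure_Type"
    "HOL-Library.Poly_Mapping"
    "HOL-Library.Z2"
    "HOL.Hull"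
begin

section \<open>Superspaces and superalgebras\<close>

text \<open>
  The ground field is a type \<open>'k\<close> of class \<^class>\<open>field_char_0\<close>. Superspaces are modules in the
  sense of HOL-Algebra over \<open>'k\<close>, viewed as a ring with full carrier, together with the two homogeneous
  components. Parities live in the field \<^typ>\<open>bit\<close>. The product of a (not necessarily associative)
  algebra and its identity are the fields \<open>mult\<close> and \<open>one\<close> inherited from rings; they
  carry no meaning for a structure that is only a superspace.
\<close>

abbreviation scalars :: "'k::field_char_0 ring"
  where "scalars \<equiv> ring_of_type_algebra"

record ('k, 'v) superspace = "('k, 'v) module" +
  grade :: "bit \<Rightarrow> 'v set"

locale superspace = module scalars V
  for V :: "('k::field_char_0, 'v, 'm) superspace_scheme" (structure) +
  assumes grade_submodule: "submodule (grade V p) scalars V"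
    and grade_disjoint: "grade V 0 \<inter> grade V 1 = {\<zero>}"
    and grade_sum: "carrier V = set_add V (grade V 0) (grade V 1)"

definition zeta :: "bit \<Rightarrow> bit \<Rightarrow> 'k::field_char_0"
  where "zeta p q = (if p * q = 0 then 1 else - 1)"

definition lin_span :: "('k::field_char_0, 'v, 'm) superspace_scheme \<Rightarrow> 'v set \<Rightarrow> 'v set"
  where "lin_span V S = (\<lambda>H. submodule H scalars V) hull S"

definition linear_map ::
    "('k::field_char_0, 'v, 'm) superspace_scheme \<Rightarrow> ('k, 'w, 'n) superspace_scheme \<Rightarrow>
      ('v \<Rightarrow> 'w) \<Rightarrow> bool"
  where "linear_map V W f \<longleftrightarrow>
    f \<in> carrier V \<rightarrow> carrier W \<and>
    (\<forall>x\<in>carrier V. \<forall>y\<in>carrier V. f (x \<oplus>\<^bsub>V\<^esub> y) = f x \<oplus>\<^bsub>W\<^esub> f y) \<and>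
    (\<forall>c. \<forall>x\<in>carrier V. f (c \<odot>\<^bsub>V\<^esub> x) = c \<odot>\<^bsub>W\<^esub> f x)"

definition even_linear ::
    "('k::field_char_0, 'v, 'm) superspace_scheme \<Rightarrow> ('k, 'w, 'n) superspace_scheme \<Rightarrow>
      ('v \<Rightarrow> 'w) \<Rightarrow> bool"
  where "even_linear V W f \<longleftrightarrow> linear_map V W f \<and> (\<forall>p. \<forall>x\<in>grade V p. f x \<in> grade W p)"

definition even_bilinear ::
    "('k::field_char_0, 'u, 'l) superspace_scheme \<Rightarrow> ('k, 'v, 'm) superspace_scheme \<Rightarrow>
      ('k, 'w, 'n) superspace_scheme \<Rightarrow> ('u \<Rightarrow> 'v \<Rightarrow> 'w) \<Rightarrow> bool"
  where "even_bilinear U V W f \<longleftrightarrow>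
    (\<forall>x\<in>carrier U. linear_map V W (f x)) \<and>
    (\<forall>y\<in>carrier V. linear_map U W (\<lambda>x. f x y)) \<and>
    (\<forall>p q. \<forall>x\<in>grade U p. \<forall>y\<in>grade V q. f x y \<in> grade W (p + q))"

locale superalgebra = superspace A
  for A :: "('k::field_char_0, 'v, 'm) superspace_scheme" (structure) +
  assumes mult_even_bilinear: "even_bilinear A A A (monoid.mult A)"

definition even_derivation ::
    "('k::field_char_0, 'v, 'm) superspace_scheme \<Rightarrow> ('v \<Rightarrow> 'v) \<Rightarrow> bool"
  where "even_derivation A D \<longleftrightarrow>
    even_linear A A D \<and>
    (\<forall>x\<in>carrier A. \<forall>y\<in>carrier A. D (x \<otimes>\<^bsub>A\<^esub> y) = D x \<otimes>\<^bsub>A\<^esub> y \<oplus>\<^bsub>A\<^esub> x \<otimes>\<^bsub>A\<^esub> D y)"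


section \<open>Lie superalgebras and their modules\<close>

text \<open>The Lie bracket is the product \<open>x \<otimes> y\<close> of the algebra.\<close>

locale lie_superalgebra = superalgebra g
  for g :: "('k::field_char_0, 'g, 'm) superspace_scheme" (structure) +
  assumes super_skew: "x \<in> grade g p \<Longrightarrow> y \<in> grade g q \<Longrightarrow>
      x \<otimes> y = \<ominus> (zeta p q \<odot> (y \<otimes> x))"
    and super_jacobi: "x \<in> grade g p \<Longrightarrow> y \<in> grade g q \<Longrightarrow> z \<in> carrier g \<Longrightarrow>
      x \<otimes> (y \<otimes> z) = (x \<otimes> y) \<otimes> z \<oplus> zeta p q \<odot> (y \<otimes> (x \<otimes> z))"

definition lie_action ::
    "('k::field_char_0, 'g, 'm) superspace_scheme \<Rightarrow> ('k, 'v, 'n) superspace_scheme \<Rightarrow>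
      ('g \<Rightarrow> 'v \<Rightarrow> 'v) \<Rightarrow> bool"
  where "lie_action g V \<rho> \<longleftrightarrow>
    even_bilinear g V V \<rho> \<and>
    (\<forall>p q. \<forall>x\<in>grade g p. \<forall>y\<in>grade g q. \<forall>v\<in>carrier V.
      \<rho> (x \<otimes>\<^bsub>g\<^esub> y) v = \<rho> x (\<rho> y v) \<ominus>\<^bsub>V\<^esub> zeta p q \<odot>\<^bsub>V\<^esub> \<rho> y (\<rho> x v))"


section \<open>Distributions and local Lie algebras\<close>

text \<open>
  A distribution \<open>a(z) = \<Sum>\<^sub>t a\<^sub>t z\<^bsup>-t-1\<^esup>\<close> is the family \<open>t \<mapsto> a\<^sub>t\<close>; likewise
  \<open>c(z,w) = \<Sum>\<^sub>s\<^sub>,\<^sub>t c\<^sub>s\<^sub>,\<^sub>t z\<^bsup>-s-1\<^esup> w\<^bsup>-t-1\<^esup>\<close> is \<open>s \<mapsto> t \<mapsto> c\<^sub>s\<^sub>,\<^sub>t\<close>. With this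
  indexing, multiplication by \<open>z\<close> raises the first index of the coefficients by one, and
  \<open>(\<partial>\<^sub>z a)\<^sub>t = - t a\<^bsub>t-1\<^esub>\<close>.
\<close>

definition ddz :: "('k::field_char_0, 'v, 'm) superspace_scheme \<Rightarrow> (int \<Rightarrow> 'v) \<Rightarrow> (int \<Rightarrow> 'v)"
  where "ddz V a = (\<lambda>t. (- of_int t) \<odot>\<^bsub>V\<^esub> a (t - 1))"

definition mult_z_minus_w ::
    "('k::field_char_0, 'v, 'm) superspace_scheme \<Rightarrow> (int \<Rightarrow> int \<Rightarrow> 'v) \<Rightarrow> (int \<Rightarrow> int \<Rightarrow> 'v)"
  where "mult_z_minus_w V c = (\<lambda>s t. c (s + 1) t \<ominus>\<^bsub>V\<^esub> c s (t + 1))"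

definition dist_bracket ::
    "('k::field_char_0, 'g, 'm) superspace_scheme \<Rightarrow> (int \<Rightarrow> 'g) \<Rightarrow> (int \<Rightarrow> 'g) \<Rightarrow>
      (int \<Rightarrow> int \<Rightarrow> 'g)"
  where "dist_bracket g a b = (\<lambda>s t. a s \<otimes>\<^bsub>g\<^esub> b t)"

definition res_z :: "(int \<Rightarrow> int \<Rightarrow> 'g) \<Rightarrow> (int \<Rightarrow> 'g)"
  where "res_z c = c 0"

text \<open>
  \<open>a(w)\<^sub>n b(w) = res\<^sub>z (z-w)\<^sup>n [a(z), b(w)]\<close>, the coefficient of \<open>\<lambda>\<^sup>n/n!\<close> in
  \<open>res\<^sub>z e\<^bsup>(z-w)\<lambda>\<^esup> [a(z), b(w)]\<close>.
\<close>

definition dist_prod ::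
    "('k::field_char_0, 'g, 'm) superspace_scheme \<Rightarrow> nat \<Rightarrow> (int \<Rightarrow> 'g) \<Rightarrow> (int \<Rightarrow> 'g) \<Rightarrow>
      (int \<Rightarrow> 'g)"
  where "dist_prod g n a b = res_z ((mult_z_minus_w g ^^ n) (dist_bracket g a b))"

definition mutually_local ::
    "('k::field_char_0, 'g, 'm) superspace_scheme \<Rightarrow> (int \<Rightarrow> 'g) \<Rightarrow> (int \<Rightarrow> 'g) \<Rightarrow> bool"
  where "mutually_local g a b \<longleftrightarrow>
    (\<exists>n. \<forall>s t. (mult_z_minus_w g ^^ n) (dist_bracket g a b) s t = \<zero>\<^bsub>g\<^esub>)"

inductive_set dist_closure ::
    "('k::field_char_0, 'g, 'm) superspace_scheme \<Rightarrow> (int \<Rightarrow> 'g) set \<Rightarrow> (int \<Rightarrow> 'g) set"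
  for g F where
    base: "a \<in> F \<Longrightarrow> a \<in> dist_closure g F"
  | zero: "(\<lambda>t. \<zero>\<^bsub>g\<^esub>) \<in> dist_closure g F"
  | add: "a \<in> dist_closure g F \<Longrightarrow> b \<in> dist_closure g F \<Longrightarrow>
      (\<lambda>t. a t \<oplus>\<^bsub>g\<^esub> b t) \<in> dist_closure g F"
  | smult: "a \<in> dist_closure g F \<Longrightarrow> (\<lambda>t. c \<odot>\<^bsub>g\<^esub> a t) \<in> dist_closure g F"
  | ddz: "a \<in> dist_closure g F \<Longrightarrow> ddz g a \<in> dist_closure g F"
  | prod: "a \<in> dist_closure g F \<Longrightarrow> b \<in> dist_closure g F \<Longrightarrow>
      dist_prod g n a b \<in> dist_closure g F"

record ('k, 'v) translation_space = "('k, 'v) superspace" +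
  transl :: "'v \<Rightarrow> 'v"

record ('k, 'g) local_lie_algebra = "('k, 'g) translation_space" +
  gen_fields :: "(int \<Rightarrow> 'g) set"

locale local_lie_algebra = lie_superalgebra g
  for g :: "('k::field_char_0, 'g, 'm) local_lie_algebra_scheme" (structure) +
  assumes transl_derivation: "even_derivation g (transl g)"
    and gen_fields_carrier: "a \<in> gen_fields g \<Longrightarrow> a t \<in> carrier g"
    and gen_fields_components: "a \<in> gen_fields g \<Longrightarrow>
      \<exists>b\<in>gen_fields g. \<exists>c\<in>gen_fields g.
        \<forall>t. b t \<in> grade g 0 \<and> c t \<in> grade g 1 \<and> a t = b t \<oplus> c t"
    and gen_fields_local: "a \<in> gen_fields g \<Longrightarrow> b \<in> gen_fields g \<Longrightarrow> mutually_local g a b"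
    and transl_gen_fields: "a \<in> gen_fields g \<Longrightarrow> transl g (a t) = ddz g a t"
    and carrier_span: "carrier g = lin_span g {a t |a t. a \<in> gen_fields g}"

definition plus_carrier :: "('k::field_char_0, 'g, 'm) local_lie_algebra_scheme \<Rightarrow> 'g set"
  where "plus_carrier g = lin_span g {a t |a t. a \<in> dist_closure g (gen_fields g) \<and> t \<ge> 0}"

definition plus_subalgebra ::
    "('k::field_char_0, 'g, 'm) local_lie_algebra_scheme \<Rightarrow>
      ('k, 'g, 'm) local_lie_algebra_scheme"
  where "plus_subalgebra g =
    g\<lparr>carrier := plus_carrier g, grade := (\<lambda>p. grade g p \<inter> plus_carrier g)\<rparr>"


section \<open>Vertex algebras\<close>

text \<open>
  The \<open>\<lambda>\<close>-bracket \<open>[a\<^sub>\<lambda> b] = \<Sum>\<^sub>n (a\<^sub>n b) \<lambda>\<^sup>n/n!\<close> is given by its coefficients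
  \<open>nprod V n a b = a\<^sub>n b\<close>; it takes values in \<open>V[\<lambda>]\<close> when only finitely many of them are
  nonzero. All identities between polynomials in \<open>\<lambda>, \<mu>\<close> are written as identities between the
  coefficients of \<open>\<lambda>\<^sup>n/n!\<close>, resp. \<open>\<lambda>\<^sup>m/m! \<mu>\<^sup>n/n!\<close>.
\<close>

record ('k, 'v) vertex_algebra = "('k, 'v) translation_space" +
  nprod :: "nat \<Rightarrow> 'v \<Rightarrow> 'v \<Rightarrow> 'v"

definition div_transl ::
    "('k::field_char_0, 'v, 'm) translation_space_scheme \<Rightarrow> nat \<Rightarrow> 'v \<Rightarrow> 'v"
  where "div_transl V n a = inverse (fact n) \<odot>\<^bsub>V\<^esub> (transl V ^^ n) a"

locale vertex_algebra = superalgebra V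
  for V :: "('k::field_char_0, 'v, 'm) vertex_algebra_scheme" (structure) +
  assumes transl_derivation: "even_derivation V (transl V)"
    and nprod_even_bilinear: "even_bilinear V V V (nprod V n)"
    and nprod_finite: "a \<in> carrier V \<Longrightarrow> b \<in> carrier V \<Longrightarrow> finite {n. nprod V n a b \<noteq> \<zero>}"
    and transl_nprod: "a \<in> carrier V \<Longrightarrow> b \<in> carrier V \<Longrightarrow>
      transl V (nprod V n a b) = nprod V n (transl V a) b \<oplus> nprod V n a (transl V b)"
    and nprod_transl_0: "a \<in> carrier V \<Longrightarrow> b \<in> carrier V \<Longrightarrow>
      nprod V 0 (transl V a) b = \<zero>"
    and nprod_transl_Suc: "a \<in> carrier V \<Longrightarrow> b \<in> carrier V \<Longrightarrow>
      nprod V (Suc n) (transl V a) b = (- of_nat (Suc n)) \<odot> nprod V n a b"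

text \<open>The coefficients of \<open>Y(a)\<close>.\<close>

definition mode ::
    "('k::field_char_0, 'v, 'm) vertex_algebra_scheme \<Rightarrow> 'v \<Rightarrow> int \<Rightarrow> 'v \<Rightarrow> 'v"
  where "mode V a t b =
    (if t \<ge> 0 then nprod V (nat t) a b else div_transl V (nat (- 1 - t)) a \<otimes>\<^bsub>V\<^esub> b)"

locale unital_vertex_algebra = vertex_algebra V
  for V :: "('k::field_char_0, 'v, 'm) vertex_algebra_scheme" (structure) +
  assumes one_carrier: "\<one> \<in> carrier V"
    and one_left: "a \<in> carrier V \<Longrightarrow> \<one> \<otimes> a = a"
    and one_right: "a \<in> carrier V \<Longrightarrow> a \<otimes> \<one> = a"

definition super_commutator ::
    "('k::field_char_0, 'v, 'm) superspace_scheme \<Rightarrow> bit \<Rightarrow> bit \<Rightarrow> 'v \<Rightarrow> 'v \<Rightarrow> 'v"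
  where "super_commutator V p q a b = a \<otimes>\<^bsub>V\<^esub> b \<ominus>\<^bsub>V\<^esub> zeta p q \<odot>\<^bsub>V\<^esub> (b \<otimes>\<^bsub>V\<^esub> a)"

text \<open>
  The formulas for coefficients below use
  \<open>\<lambda>\<^sup>i/i! (\<mu>-\<lambda>)\<^sup>j/j! = \<Sum>\<^sub>k (-1)\<^sup>k (i+k choose i) \<lambda>\<^bsup>i+k\<^esup>/(i+k)! \<mu>\<^bsup>j-k\<^esup>/(j-k)!\<close>
  in \<open>lambda_jacobi\<close>,
  \<open>(-\<lambda>-T)\<^sup>t/t! = \<Sum>\<^bsub>n+j=t\<^esub> (-1)\<^sup>t \<lambda>\<^sup>n/n! T\<^sup>j/j!\<close> in \<open>lambda_skew\<close>, and
  \<open>\<lambda>\<^sup>m/m! \<integral>\<^sub>0\<^sup>\<lambda> \<mu>\<^sup>k/k! d\<mu> = (m+k+1 choose m) \<lambda>\<^bsup>m+k+1\<^esup>/(m+k+1)!\<close> in \<open>wick\<close>.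
  The sums over the values of \<open>i\<close> or \<open>j\<close> with nonzero products are the sums over all \<open>i\<close> or \<open>j\<close>.
\<close>

locale associative_vertex_algebra = vertex_algebra V
  for V :: "('k::field_char_0, 'v, 'm) vertex_algebra_scheme" (structure) +
  assumes left_symmetric: "a \<in> grade V p \<Longrightarrow> b \<in> grade V q \<Longrightarrow> c \<in> carrier V \<Longrightarrow>
      super_commutator V p q a b \<otimes> c =
        a \<otimes> (b \<otimes> c) \<ominus> zeta p q \<odot> (b \<otimes> (a \<otimes> c))"
    and lambda_jacobi: "a \<in> grade V p \<Longrightarrow> b \<in> grade V q \<Longrightarrow> c \<in> carrier V \<Longrightarrow>
      nprod V n (nprod V m a b) c =
        (\<Oplus>i\<in>{..m}. ((- 1) ^ (m - i) * of_nat (m choose i)) \<odot>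
          (nprod V i a (nprod V (n + m - i) b c)
            \<ominus> zeta p q \<odot> nprod V (n + m - i) b (nprod V i a c)))"
    and lambda_skew: "a \<in> grade V p \<Longrightarrow> b \<in> grade V q \<Longrightarrow>
      nprod V n a b =
        \<ominus> (zeta p q \<odot> (\<Oplus>j\<in>{j. nprod V (n + j) b a \<noteq> \<zero>}.
          (- 1) ^ (n + j) \<odot> div_transl V j (nprod V (n + j) b a)))"
    and commutator_formula: "a \<in> grade V p \<Longrightarrow> b \<in> grade V q \<Longrightarrow>
      super_commutator V p q a b =
        (\<Oplus>i\<in>{i. nprod V i a b \<noteq> \<zero>}. (- 1) ^ i \<odot> div_transl V (Suc i) (nprod V i a b))"
    and wick: "a \<in> grade V p \<Longrightarrow> b \<in> grade V q \<Longrightarrow> c \<in> carrier V \<Longrightarrow>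
      nprod V n a (b \<otimes> c) =
        nprod V n a b \<otimes> c \<oplus> zeta p q \<odot> (b \<otimes> nprod V n a c)
        \<oplus> (\<Oplus>m\<in>{..<n}. of_nat (n choose m) \<odot> nprod V (n - 1 - m) (nprod V m a b) c)"

record ('k, 'v, 'g) vertex_algebra_over = "('k, 'v) vertex_algebra" +
  act :: "'g \<Rightarrow> 'v \<Rightarrow> 'v"

definition vertex_algebra_over ::
    "('k::field_char_0, 'g, 'm) local_lie_algebra_scheme \<Rightarrow>
      ('k, 'v, 'g, 'n) vertex_algebra_over_scheme \<Rightarrow> bool"
  where "vertex_algebra_over g V \<longleftrightarrow>
    vertex_algebra V \<and>
    lie_action g V (act V) \<and>
    (\<forall>a\<in>gen_fields g. \<exists>u\<in>carrier V. \<forall>t. \<forall>v\<in>carrier V. act V (a t) v = mode V u t v)"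

definition assoc_unital_vertex_algebra_over ::
    "('k::field_char_0, 'g, 'm) local_lie_algebra_scheme \<Rightarrow>
      ('k, 'v, 'g, 'n) vertex_algebra_over_scheme \<Rightarrow> bool"
  where "assoc_unital_vertex_algebra_over g V \<longleftrightarrow>
    vertex_algebra_over g V \<and> associative_vertex_algebra V \<and> unital_vertex_algebra V"

text \<open>
  Morphisms are extensional, i.e. \<^const>\<open>undefined\<close> outside the carrier, so that equality of
  morphisms is equality of functions.
\<close>

definition unital_vertex_algebra_morphism ::
    "('k::field_char_0, 'v, 'm) vertex_algebra_scheme \<Rightarrow>
      ('k, 'w, 'n) vertex_algebra_scheme \<Rightarrow> ('v \<Rightarrow> 'w) \<Rightarrow> bool"
  where "unital_vertex_algebra_morphism V W f \<longleftrightarrow>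
    f \<in> extensional (carrier V) \<and>
    even_linear V W f \<and>
    (\<forall>a\<in>carrier V. f (transl V a) = transl W (f a)) \<and>
    (\<forall>a\<in>carrier V. \<forall>b\<in>carrier V. f (a \<otimes>\<^bsub>V\<^esub> b) = f a \<otimes>\<^bsub>W\<^esub> f b) \<and>
    (\<forall>n. \<forall>a\<in>carrier V. \<forall>b\<in>carrier V. f (nprod V n a b) = nprod W n (f a) (f b)) \<and>
    f \<one>\<^bsub>V\<^esub> = \<one>\<^bsub>W\<^esub>"

definition unital_vertex_algebra_over_morphism ::
    "('k::field_char_0, 'g, 'l) local_lie_algebra_scheme \<Rightarrow>
      ('k, 'v, 'g, 'm) vertex_algebra_over_scheme \<Rightarrow>
      ('k, 'w, 'g, 'n) vertex_algebra_over_scheme \<Rightarrow> ('v \<Rightarrow> 'w) \<Rightarrow> bool"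
  where "unital_vertex_algebra_over_morphism g V W f \<longleftrightarrow>
    unital_vertex_algebra_morphism V W f \<and>
    (\<forall>x\<in>carrier g. \<forall>v\<in>carrier V. f (act V x v) = act W x (f v))"


section \<open>Enveloping algebras and induced modules\<close>

definition quot_space ::
    "('k::field_char_0, 'v, 'm) superspace_scheme \<Rightarrow> 'v set \<Rightarrow> ('k, 'v set) superspace"
  where "quot_space M H =
    \<lparr>carrier = a_rcosets\<^bsub>M\<^esub> H, monoid.mult = rcoset_mult M H, one = H +>\<^bsub>M\<^esub> \<one>\<^bsub>M\<^esub>,
     ring.zero = H, add = set_add M, module.smult = (\<lambda>c C. \<Union>x\<in>C. H +>\<^bsub>M\<^esub> (c \<odot>\<^bsub>M\<^esub> x)),
     grade = (\<lambda>p. (\<lambda>x. H +>\<^bsub>M\<^esub> x) ` grade M p)\<rparr>"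

text \<open>
  The free associative algebra on the set \<open>carrier g\<close>: finitely supported functions on words.
  A word of homogeneous letters has as parity the sum of the parities of its letters. The direct sum
  decomposition of the grading holds only after passing to the enveloping algebra.
\<close>

definition free_algebra ::
    "('k::field_char_0, 'g, 'm) superspace_scheme \<Rightarrow> ('k, 'g list \<Rightarrow>\<^sub>0 'k) superspace"
  where "free_algebra g =
    \<lparr>carrier = {f. Poly_Mapping.keys f \<subseteq> lists (carrier g)},
     monoid.mult = (\<lambda>f h. \<Sum>u\<in>Poly_Mapping.keys f. \<Sum>v\<in>Poly_Mapping.keys h.
       Poly_Mapping.single (u @ v) (Poly_Mapping.lookup f u * Poly_Mapping.lookup h v)),
     one = Poly_Mapping.single [] 1,
     ring.zero = 0, add = (+), module.smult = (\<lambda>c. Poly_Mapping.map ((*) c)),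
     grade = (\<lambda>p. {f. \<forall>u\<in>Poly_Mapping.keys f.
       \<exists>ps. list_all2 (\<lambda>x q. x \<in> grade g q) u ps \<and> sum_list ps = p})\<rparr>"

definition letter :: "'g \<Rightarrow> ('g list \<Rightarrow>\<^sub>0 'k::field_char_0)"
  where "letter x = Poly_Mapping.single [x] 1"

definition env_relations ::
    "('k::field_char_0, 'g, 'm) superspace_scheme \<Rightarrow> ('g list \<Rightarrow>\<^sub>0 'k) set"
  where "env_relations g =
    {letter (x \<oplus>\<^bsub>g\<^esub> y) - (letter x + letter y) |x y. x \<in> carrier g \<and> y \<in> carrier g} \<union>
    {letter (c \<odot>\<^bsub>g\<^esub> x) - Poly_Mapping.map ((*) c) (letter x) |c x. x \<in> carrier g} \<union>
    {letter x \<otimes>\<^bsub>free_algebra g\<^esub> letter y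
       - Poly_Mapping.map ((*) (zeta p q)) (letter y \<otimes>\<^bsub>free_algebra g\<^esub> letter x)
       - letter (x \<otimes>\<^bsub>g\<^esub> y) |x y p q. x \<in> grade g p \<and> y \<in> grade g q}"

definition env_ideal ::
    "('k::field_char_0, 'g, 'm) superspace_scheme \<Rightarrow> ('g list \<Rightarrow>\<^sub>0 'k) set"
  where "env_ideal g = Idl\<^bsub>free_algebra g\<^esub> (env_relations g)"

definition env_algebra ::
    "('k::field_char_0, 'g, 'm) superspace_scheme \<Rightarrow> ('k, ('g list \<Rightarrow>\<^sub>0 'k) set) superspace"
  where "env_algebra g = quot_space (free_algebra g) (env_ideal g)"

definition env_embed ::
    "('k::field_char_0, 'g, 'm) superspace_scheme \<Rightarrow> 'g \<Rightarrow> ('g list \<Rightarrow>\<^sub>0 'k) set"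
  where "env_embed g x = env_ideal g +>\<^bsub>free_algebra g\<^esub> letter x"

text \<open>The canonical map \<open>U(h) \<rightarrow> U(g)\<close> for a Lie subalgebra \<open>h\<close> of \<open>g\<close>; it does not mention \<open>h\<close>
  since representatives in the free algebra on \<open>h\<close> are elements of the free algebra on \<open>g\<close>.\<close>

definition env_incl ::
    "('k::field_char_0, 'g, 'm) superspace_scheme \<Rightarrow> ('g list \<Rightarrow>\<^sub>0 'k) set \<Rightarrow>
      ('g list \<Rightarrow>\<^sub>0 'k) set"
  where "env_incl g C = (\<Union>f\<in>C. env_ideal g +>\<^bsub>free_algebra g\<^esub> f)"

text \<open>The extension of a Lie algebra action on \<open>N\<close> to the enveloping algebra; all representatives
  \<open>f\<close> of the coset \<open>C\<close> give the same value.\<close>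

definition env_act ::
    "('k::field_char_0, 'n, 'm) superspace_scheme \<Rightarrow> ('g \<Rightarrow> 'n \<Rightarrow> 'n) \<Rightarrow>
      ('g list \<Rightarrow>\<^sub>0 'k) set \<Rightarrow> 'n \<Rightarrow> 'n"
  where "env_act N \<rho> C n = the_elem ((\<lambda>f.
    \<Oplus>\<^bsub>N\<^esub>u\<in>Poly_Mapping.keys f. Poly_Mapping.lookup f u \<odot>\<^bsub>N\<^esub> foldr \<rho> u n) ` C)"

text \<open>
  The tensor product \<open>M \<otimes>\<^sub>A N\<close> over an algebra with carrier \<open>A\<close> acting on \<open>M\<close> from the right by \<open>r\<close> and on \<open>N\<close>
  from the left by \<open>l\<close>: the vector space on \<open>M \<times> N\<close> modulo the span of the bilinearity and
  balancing relations.
\<close>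

definition pair_space ::
    "('k::field_char_0, 'm, 'e) superspace_scheme \<Rightarrow> ('k, 'n, 'f) superspace_scheme \<Rightarrow>
      ('k, 'm \<times> 'n \<Rightarrow>\<^sub>0 'k) superspace"
  where "pair_space M N =
    \<lparr>carrier = {f. Poly_Mapping.keys f \<subseteq> carrier M \<times> carrier N},
     monoid.mult = undefined, one = undefined,
     ring.zero = 0, add = (+), module.smult = (\<lambda>c. Poly_Mapping.map ((*) c)),
     grade = (\<lambda>p. {f. \<forall>(m, n)\<in>Poly_Mapping.keys f.
       \<exists>q r. m \<in> grade M q \<and> n \<in> grade N r \<and> q + r = p})\<rparr>"

definition pair :: "'m \<Rightarrow> 'n \<Rightarrow> ('m \<times> 'n \<Rightarrow>\<^sub>0 'k::field_char_0)"
  where "pair m n = Poly_Mapping.single (m, n) 1"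

definition tensor_relations ::
    "'a set \<Rightarrow> ('k::field_char_0, 'm, 'e) superspace_scheme \<Rightarrow> ('m \<Rightarrow> 'a \<Rightarrow> 'm) \<Rightarrow>
      ('k, 'n, 'f) superspace_scheme \<Rightarrow> ('a \<Rightarrow> 'n \<Rightarrow> 'n) \<Rightarrow> ('m \<times> 'n \<Rightarrow>\<^sub>0 'k) set"
  where "tensor_relations A M r N l = lin_span (pair_space M N)
    ({pair (m \<oplus>\<^bsub>M\<^esub> m') n - (pair m n + pair m' n) |m m' n.
        m \<in> carrier M \<and> m' \<in> carrier M \<and> n \<in> carrier N} \<union>
     {pair m (n \<oplus>\<^bsub>N\<^esub> n') - (pair m n + pair m n') |m n n'.
        m \<in> carrier M \<and> n \<in> carrier N \<and> n' \<in> carrier N} \<union>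
     {pair (c \<odot>\<^bsub>M\<^esub> m) n - Poly_Mapping.map ((*) c) (pair m n) |c m n.
        m \<in> carrier M \<and> n \<in> carrier N} \<union>
     {pair m (c \<odot>\<^bsub>N\<^esub> n) - Poly_Mapping.map ((*) c) (pair m n) |c m n.
        m \<in> carrier M \<and> n \<in> carrier N} \<union>
     {pair (r m a) n - pair m (l a n) |m a n.
        m \<in> carrier M \<and> a \<in> A \<and> n \<in> carrier N})"

definition tensor_space ::
    "'a set \<Rightarrow> ('k::field_char_0, 'm, 'e) superspace_scheme \<Rightarrow> ('m \<Rightarrow> 'a \<Rightarrow> 'm) \<Rightarrow>
      ('k, 'n, 'f) superspace_scheme \<Rightarrow> ('a \<Rightarrow> 'n \<Rightarrow> 'n) \<Rightarrow>
      ('k, ('m \<times> 'n \<Rightarrow>\<^sub>0 'k) set) superspace"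
  where "tensor_space A M r N l = quot_space (pair_space M N) (tensor_relations A M r N l)"

text \<open>The trivial module is the ground field, in even degree, with all of \<open>h\<close> acting by zero.\<close>

definition scalar_space :: "('k::field_char_0, 'k) superspace"
  where "scalar_space =
    \<lparr>carrier = UNIV, monoid.mult = (*), one = 1, ring.zero = 0, add = (+), module.smult = (*),
     grade = (\<lambda>p. if p = 0 then UNIV else {0})\<rparr>"

definition trivial_act :: "'g \<Rightarrow> 'k::field_char_0 \<Rightarrow> 'k"
  where "trivial_act x c = 0"


section \<open>The module \<open>V(g)\<close>\<close>

type_synonym ('k, 'g) env = "('g list \<Rightarrow>\<^sub>0 'k) set"
type_synonym ('k, 'g) univ = "(('k, 'g) env \<times> 'k \<Rightarrow>\<^sub>0 'k) set"

definition univ_relations ::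
    "('k::field_char_0, 'g, 'm) local_lie_algebra_scheme \<Rightarrow> (('k, 'g) env \<times> 'k \<Rightarrow>\<^sub>0 'k) set"
  where "univ_relations g =
    tensor_relations (carrier (env_algebra (plus_subalgebra g)))
      (env_algebra g) (\<lambda>u a. u \<otimes>\<^bsub>env_algebra g\<^esub> env_incl g a)
      scalar_space (env_act scalar_space trivial_act)"

definition univ_space ::
    "('k::field_char_0, 'g, 'm) local_lie_algebra_scheme \<Rightarrow> ('k, ('k, 'g) univ) superspace"
  where "univ_space g =
    tensor_space (carrier (env_algebra (plus_subalgebra g)))
      (env_algebra g) (\<lambda>u a. u \<otimes>\<^bsub>env_algebra g\<^esub> env_incl g a)
      scalar_space (env_act scalar_space trivial_act)"

text \<open>The action \<open>x (u \<otimes> c) = (x u) \<otimes> c\<close>.\<close>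

definition univ_act ::
    "('k::field_char_0, 'g, 'm) local_lie_algebra_scheme \<Rightarrow> 'g \<Rightarrow> ('k, 'g) univ \<Rightarrow>
      ('k, 'g) univ"
  where "univ_act g x C = (\<Union>f\<in>C.
    univ_relations g +>\<^bsub>pair_space (env_algebra g) scalar_space\<^esub>
      (\<Sum>(u, c)\<in>Poly_Mapping.keys f.
        Poly_Mapping.single (env_embed g x \<otimes>\<^bsub>env_algebra g\<^esub> u, c) (Poly_Mapping.lookup f (u, c))))"

definition univ_one ::
    "('k::field_char_0, 'g, 'm) local_lie_algebra_scheme \<Rightarrow> ('k, 'g) univ"
  where "univ_one g =
    univ_relations g +>\<^bsub>pair_space (env_algebra g) scalar_space\<^esub> pair \<one>\<^bsub>env_algebra g\<^esub> 1"

text \<open>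
  \<open>V\<close> is \<open>V(g)\<close> with its vertex algebra structure: an associative vertex algebra over \<open>g\<close> whose
  underlying \<open>g\<close>-module is \<open>U(g) \<otimes> K\<close> and which has identity \<open>1 \<otimes> 1\<close>. The translation operator,
  the product and the \<open>\<lambda>\<close>-bracket of \<open>V\<close> are not prescribed, as they are determined by these
  conditions.
\<close>

definition is_universal_vertex_algebra ::
    "('k::field_char_0, 'g) local_lie_algebra \<Rightarrow>
      ('k, ('k, 'g) univ, 'g) vertex_algebra_over \<Rightarrow> bool"
  where "is_universal_vertex_algebra g V \<longleftrightarrow>
    carrier V = carrier (univ_space g) \<and>
    ring.zero V = ring.zero (univ_space g) \<and>
    add V = add (univ_space g) \<and>
    module.smult V = module.smult (univ_space g) \<and>
    grade V = grade (univ_space g) \<and>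
    act V = univ_act g \<and>
    one V = univ_one g \<and>
    assoc_unital_vertex_algebra_over g V"

end

theory Submission
  imports Defs
begin

text \<open>
  The space \<open>V(g)\<close> is spanned by words in the elements of \<open>g\<close> applied to \<open>1\<close>. In an associative unital
  vertex algebra \<open>W\<close> over \<open>g\<close> one has \<open>u\<^sub>t 1 = 0\<close> for \<open>t \<ge> 0\<close>, so the nonnegative modes of the generating
  fields, and hence their brackets, annihilate \<open>1\<close>; this gives a unique \<open>g\<close>-module map
  \<open>f : V(g) \<rightarrow> W\<close> with \<open>f 1 = 1\<close>. If \<open>a(z)\<close> is a generating field, it is \<open>Y(u)\<close> on \<open>V(g)\<close> for
  \<open>u = a\<^bsub>-1\<^esub> 1\<close> and \<open>Y(f u)\<close> on \<open>W\<close>, so that \<open>f\<close> intertwines \<open>Y(u)\<close> with \<open>Y(f u)\<close> and, by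
  \<open>T u\<^sub>t = u\<^sub>t T - t u\<^bsub>t-1\<^esub>\<close>, commutes with \<open>T\<close>. The \<open>x\<close> such that \<open>f\<close> intertwines left
  multiplication by \<open>x\<close> with left multiplication by \<open>f x\<close>, for all products, are closed under
  all products: skew-symmetry and the commutator formula exchange left and right multiplication, and
  the remaining axioms express products with \<open>a b\<close> or \<open>a\<^sub>n b\<close> through products with \<open>a\<close> and \<open>b\<close>.
  As \<open>V(g)\<close> is spanned by iterated products of the \<open>u\<close>'s, \<open>f\<close> is a morphism.
\<close>

section \<open>Superspaces and vertex algebras\<close>

lemma scalars_simps [simp]:
  "carrier scalars = (UNIV :: 'k::field_char_0 set)"
  "\<zero>\<^bsub>scalars\<^esub> = (0::'k)" "\<one>\<^bsub>scalars\<^esub> = (1::'k)"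
  "a \<oplus>\<^bsub>scalars\<^esub> b = a + (b::'k)" "a \<otimes>\<^bsub>scalars\<^esub> b = a * (b::'k)"
  by (simp_all add: ring_of_type_algebra_def)

locale vspace = module scalars M
  for M :: "('k::field_char_0, 'v, 'm) module_scheme" (structure)
begin

lemma sm_closed [simp]: "x \<in> carrier M \<Longrightarrow> (c::'k) \<odot> x \<in> carrier M"
  using smult_closed[of c x] by simp

lemma sm_add_left: "x \<in> carrier M \<Longrightarrow> (a + b::'k) \<odot> x = a \<odot> x \<oplus> b \<odot> x"
  using smult_l_distr[of a b x] by simp

lemma sm_add_right: "x \<in> carrier M \<Longrightarrow> y \<in> carrier M \<Longrightarrow> (a::'k) \<odot> (x \<oplus> y) = a \<odot> x \<oplus> a \<odot> y"
  using smult_r_distr[of a x y] by simp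

lemma sm_assoc: "x \<in> carrier M \<Longrightarrow> (a::'k) \<odot> (b \<odot> x) = (a * b) \<odot> x"
  using smult_assoc1[of a b x] by simp

lemma sm_one [simp]: "x \<in> carrier M \<Longrightarrow> (1::'k) \<odot> x = x"
  using smult_one[of x] by simp

lemma sm_zero_left [simp]: "x \<in> carrier M \<Longrightarrow> (0::'k) \<odot> x = \<zero>"
  using smult_l_null[of x] by simp

lemma sm_zero_right [simp]: "(c::'k) \<odot> \<zero> = \<zero>"
  using smult_r_null[of c] by simp

lemma sm_minus_right: "x \<in> carrier M \<Longrightarrow> (c::'k) \<odot> (\<ominus> x) = \<ominus> (c \<odot> x)"
  using smult_r_minus[of c x] by simp

lemma sm_minus_one: "x \<in> carrier M \<Longrightarrow> (- 1::'k) \<odot> x = \<ominus> x"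
  using sm_add_left[of x "-1" 1] by (simp add: M.add.inv_equality)

lemma sm_eq_zeroD: "x \<in> carrier M \<Longrightarrow> (c::'k) \<odot> x = \<zero> \<Longrightarrow> c \<noteq> 0 \<Longrightarrow> x = \<zero>"
  using sm_assoc[of x "inverse c" c] by simp

text \<open>Closure under negatives comes from scaling by \<open>-1\<close>.\<close>

lemma subspaceI:
  assumes "H \<subseteq> carrier M" "\<zero> \<in> H" "\<And>x y. x \<in> H \<Longrightarrow> y \<in> H \<Longrightarrow> x \<oplus> y \<in> H"
    "\<And>(c::'k) x. x \<in> H \<Longrightarrow> c \<odot> x \<in> H"
  shows "submodule H scalars M"
proof (rule submoduleI)
  fix a assume a: "a \<in> H"
  then show "\<ominus> a \<in> H" using assms(4)[OF a, of "-1"] assms(1) sm_minus_one by auto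
qed (use assms in auto)

lemma subspaceD:
  assumes "submodule H scalars M"
  shows "H \<subseteq> carrier M" "\<zero> \<in> H" "\<And>x y. x \<in> H \<Longrightarrow> y \<in> H \<Longrightarrow> x \<oplus> y \<in> H"
    "\<And>(c::'k) x. x \<in> H \<Longrightarrow> c \<odot> x \<in> H" "\<And>x. x \<in> H \<Longrightarrow> \<ominus> x \<in> H"
  using submoduleE[OF assms] submodule.axioms(1)[OF assms] subgroup.one_closed by fastforce+

lemma minus_right_cancel:
  assumes "x \<in> carrier M" "y \<in> carrier M" "z \<in> carrier M"
  shows "x \<ominus> z = y \<ominus> z \<longleftrightarrow> x = y"
  using assms by (simp add: a_minus_def)

lemma minus_left_cancel:
  assumes "x \<in> carrier M" "y \<in> carrier M" "z \<in> carrier M"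
  shows "z \<ominus> x = z \<ominus> y \<longleftrightarrow> x = y"
  using assms by (simp add: a_minus_def) (metis M.minus_minus)

lemma sm_cancel:
  assumes "x \<in> carrier M" "y \<in> carrier M" "c \<noteq> (0::'k)"
  shows "c \<odot> x = c \<odot> y \<longleftrightarrow> x = y"
proof
  assume "c \<odot> x = c \<odot> y"
  then have "inverse c \<odot> (c \<odot> x) = inverse c \<odot> (c \<odot> y)" by simp
  then show "x = y" using assms by (simp add: sm_assoc)
qed simp

lemma minus_eq_zero_iff:
  assumes "x \<in> carrier M" "y \<in> carrier M"
  shows "x \<ominus> y = \<zero> \<longleftrightarrow> x = y"
  using minus_right_cancel[OF assms assms(2)] assms by (simp add: a_minus_def M.r_neg)

end

section \<open>Subspaces, linear spans and linear maps\<close>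

lemma Int_submodules:
  assumes "vspace M" "\<And>H. H \<in> \<H> \<Longrightarrow> submodule H scalars M" "\<H> \<noteq> {}"
  shows "submodule (\<Inter>\<H>) scalars (M :: ('k::field_char_0, 'v, 'm) module_scheme)"
proof -
  interpret vspace M by fact
  note D = subspaceD[OF assms(2)]
  show ?thesis
  proof (rule subspaceI)
    show "\<Inter>\<H> \<subseteq> carrier M" using assms(3) D(1) by blast
  qed (use D(2-4) in auto)
qed

lemma lin_span_submodule:
  fixes M :: "('k::field_char_0, 'v, 'm) superspace_scheme"
  assumes "vspace M" "S \<subseteq> carrier M"
  shows "submodule (lin_span M S) scalars M"
  unfolding lin_span_def hull_def
  using assms module.carrier_is_submodule[of scalars M]
  by (intro Int_submodules) (auto simp: vspace_def)

lemma lin_span_induct: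
  fixes M :: "('k::field_char_0, 'v, 'm) superspace_scheme"
  assumes "submodule H scalars M" "S \<subseteq> H"
  shows "lin_span M S \<subseteq> H"
  using assms unfolding lin_span_def by (simp add: hull_minimal)

lemma lin_span_superset:
  fixes M :: "('k::field_char_0, 'v, 'm) superspace_scheme"
  shows "S \<subseteq> lin_span M S"
  unfolding lin_span_def by (rule hull_subset)

text \<open>Parity is left out on purpose: left multiplication by an odd vector and the action of an
  odd element of \<open>g\<close> are linear but not even.\<close>

locale linmap = V: vspace V + W: vspace W
  for V :: "('k::field_char_0, 'v, 'm) superspace_scheme"
    and W :: "('k, 'w, 'n) superspace_scheme" +
  fixes f assumes lin: "linear_map V W f"
begin

lemma closed [simp]: "x \<in> carrier V \<Longrightarrow> f x \<in> carrier W"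
  using lin by (auto simp: linear_map_def)

lemma add: "x \<in> carrier V \<Longrightarrow> y \<in> carrier V \<Longrightarrow> f (x \<oplus>\<^bsub>V\<^esub> y) = f x \<oplus>\<^bsub>W\<^esub> f y"
  using lin by (simp add: linear_map_def)

lemma sm: "x \<in> carrier V \<Longrightarrow> f (c \<odot>\<^bsub>V\<^esub> x) = c \<odot>\<^bsub>W\<^esub> f x"
  using lin by (simp add: linear_map_def)

lemma zero [simp]: "f \<zero>\<^bsub>V\<^esub> = \<zero>\<^bsub>W\<^esub>"
  using sm[of "\<zero>\<^bsub>V\<^esub>" 0] by simp

lemma neg: "x \<in> carrier V \<Longrightarrow> f (\<ominus>\<^bsub>V\<^esub> x) = \<ominus>\<^bsub>W\<^esub> f x"
  using sm[of x "-1"] by (simp add: V.sm_minus_one W.sm_minus_one)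

lemma minus: "x \<in> carrier V \<Longrightarrow> y \<in> carrier V \<Longrightarrow> f (x \<ominus>\<^bsub>V\<^esub> y) = f x \<ominus>\<^bsub>W\<^esub> f y"
  by (simp add: a_minus_def add neg)

lemma sum: "(\<And>i. i \<in> I \<Longrightarrow> F i \<in> carrier V) \<Longrightarrow> f (finsum V F I) = finsum W (\<lambda>i. f (F i)) I"
proof (induction I rule: infinite_finite_induct)
  case (insert i I)
  then have "F \<in> I \<rightarrow> carrier V" "(\<lambda>i. f (F i)) \<in> I \<rightarrow> carrier W" by auto
  with insert show ?case by (simp add: add)
qed (simp_all add: V.M.add.finprod_infinite W.M.add.finprod_infinite)

end

lemma linmap_comp:
  assumes "linmap U V k" "linmap V W h"
  shows "linmap U W (\<lambda>x. h (k x))"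
proof -
  interpret k: linmap U V k by fact
  interpret h: linmap V W h by fact
  show ?thesis
    by unfold_locales (auto simp: linear_map_def k.add k.sm h.add h.sm)
qed

section \<open>Homogeneous components and even bilinear maps\<close>

lemma (in superspace) vspace: "vspace V"
  by (simp add: vspace_def module_axioms)

sublocale superspace \<subseteq> vspace V
  by (rule vspace)

lemma superspace_linmapI:
  assumes "superspace V" "superspace W" "linear_map V W f"
  shows "linmap V W f"
  using assms superspace.vspace[OF assms(1)] superspace.vspace[OF assms(2)]
  by (simp add: linmap_def linmap_axioms_def)

context superspace
begin

lemma grade_closed [simp]: "x \<in> grade V p \<Longrightarrow> x \<in> carrier V"
  using grade_submodule subspaceD(1) by blast

lemmas grade_zero [simp] = subspaceD(2)[OF grade_submodule]
  and grade_add = subspaceD(3)[OF grade_submodule]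
  and grade_sm = subspaceD(4)[OF grade_submodule]
  and grade_neg = subspaceD(5)[OF grade_submodule]

lemma grade_decomp:
  assumes "x \<in> carrier V"
  obtains x0 x1 where "x0 \<in> grade V 0" "x1 \<in> grade V 1" "x = x0 \<oplus> x1"
  using assms grade_sum by (auto simp: set_add_def')

lemma grade_unique:
  assumes "x \<in> grade V p" "x \<in> grade V q" "p \<noteq> q"
  shows "x = \<zero>"
  using assms grade_disjoint by (cases p; cases q) auto

text \<open>Since \<open>x = \<ominus> y\<close>, both vectors lie in both components, which meet
  only in zero.\<close>

lemma grade_sum_zero:
  assumes "x \<in> grade V p" "y \<in> grade V q" "p \<noteq> q" "x \<oplus> y = \<zero>"
  shows "x = \<zero> \<and> y = \<zero>"
proof -
  have "x = \<ominus> y" using assms by (metis M.add.inv_equality grade_closed)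
  then have "x = \<zero>" using assms grade_neg grade_unique by metis
  then show ?thesis using assms by simp
qed

end

text \<open>The axioms with signs speak about homogeneous vectors; this carries identities proved
  for those to the whole carrier.\<close>

lemma linear_map_ext:
  assumes "linmap V W F" "linmap V W G" "superspace V"
    "\<And>p x. x \<in> grade V p \<Longrightarrow> F x = G x" "x \<in> carrier V"
  shows "F x = G x"
proof -
  interpret F: linmap V W F by fact
  interpret G: linmap V W G by fact
  interpret superspace V by fact
  obtain x0 x1 where "x0 \<in> grade V 0" "x1 \<in> grade V 1" "x = x0 \<oplus>\<^bsub>V\<^esub> x1"
    using grade_decomp[OF assms(5)] .
  then show ?thesis using assms(4) by (simp add: F.add G.add)
qed

context
  fixes A B C \<beta>
  assumes sp: "superspace A" "superspace B" "superspace C" and bil: "even_bilinear A B C \<beta>"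
begin

lemma even_bilinear_right: "x \<in> carrier A \<Longrightarrow> linmap B C (\<beta> x)"
  using bil superspace_linmapI[OF sp(2,3)] by (simp add: even_bilinear_def)

lemma even_bilinear_left: "y \<in> carrier B \<Longrightarrow> linmap A C (\<lambda>x. \<beta> x y)"
  using bil superspace_linmapI[OF sp(1,3)] by (simp add: even_bilinear_def)

lemma even_bilinear_grade: "x \<in> grade A p \<Longrightarrow> y \<in> grade B q \<Longrightarrow> \<beta> x y \<in> grade C (p + q)"
  using bil unfolding even_bilinear_def by blast

end

context superalgebra
begin

lemmas mult_right = even_bilinear_right[OF superspace_axioms superspace_axioms superspace_axioms mult_even_bilinear]
  and mult_left = even_bilinear_left[OF superspace_axioms superspace_axioms superspace_axioms mult_even_bilinear]
  and mult_grade = even_bilinear_grade[OF superspace_axioms superspace_axioms superspace_axioms mult_even_bilinear]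

lemma mult_closed [simp]: "x \<in> carrier A \<Longrightarrow> y \<in> carrier A \<Longrightarrow> x \<otimes> y \<in> carrier A"
  using linmap.closed[OF mult_right] .

end

section \<open>Modes and the translation operator\<close>

context vertex_algebra
begin

lemmas nprod_right = even_bilinear_right[OF superspace_axioms superspace_axioms superspace_axioms nprod_even_bilinear]
  and nprod_left = even_bilinear_left[OF superspace_axioms superspace_axioms superspace_axioms nprod_even_bilinear]

lemma nprod_closed [simp]: "x \<in> carrier V \<Longrightarrow> y \<in> carrier V \<Longrightarrow> nprod V n x y \<in> carrier V"
  using linmap.closed[OF nprod_right] .

lemma transl_linmap: "linmap V V (transl V)"
  using transl_derivation superspace_axioms
  by (auto simp: even_derivation_def even_linear_def intro: superspace_linmapI)

lemma transl_closed [simp]: "x \<in> carrier V \<Longrightarrow> transl V x \<in> carrier V"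
  using linmap.closed[OF transl_linmap] .

lemma transl_grade: "x \<in> grade V p \<Longrightarrow> transl V x \<in> grade V p"
  using transl_derivation by (auto simp: even_derivation_def even_linear_def)

lemma transl_mult: "x \<in> carrier V \<Longrightarrow> y \<in> carrier V \<Longrightarrow>
   transl V (x \<otimes> y) = transl V x \<otimes> y \<oplus> x \<otimes> transl V y"
  using transl_derivation by (auto simp: even_derivation_def)

lemma transl_funpow_closed [simp]: "x \<in> carrier V \<Longrightarrow> (transl V ^^ n) x \<in> carrier V"
  by (induction n) auto

lemma div_transl_closed [simp]: "x \<in> carrier V \<Longrightarrow> div_transl V n x \<in> carrier V"
  by (simp add: div_transl_def)

lemma div_transl_grade: "x \<in> grade V p \<Longrightarrow> div_transl V n x \<in> grade V p"
proof -
  assume "x \<in> grade V p"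
  then have "(transl V ^^ n) x \<in> grade V p" by (induction n) (auto intro: transl_grade)
  then show ?thesis by (simp add: div_transl_def grade_sm)
qed

lemma div_transl_0 [simp]: "x \<in> carrier V \<Longrightarrow> div_transl V 0 x = x"
  by (simp add: div_transl_def)

lemma transl_div_transl:
  assumes x: "x \<in> carrier V"
  shows "transl V (div_transl V n x) = of_nat (Suc n) \<odot> div_transl V (Suc n) x"
proof -
  have "inverse (fact n) = (of_nat (Suc n) :: 'k) * inverse (fact (Suc n))"
    by (simp add: field_simps del: of_nat_Suc)
  then show ?thesis using x
    by (simp add: div_transl_def linmap.sm[OF transl_linmap] sm_assoc del: fact_Suc of_nat_Suc)
qed

lemma div_transl_zero [simp]: "div_transl V n \<zero> = \<zero>"
proof -
  have "(transl V ^^ n) \<zero> = \<zero>" by (induction n) (auto simp: linmap.zero[OF transl_linmap])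
  then show ?thesis by (simp add: div_transl_def)
qed

lemma mode_linmap: "a \<in> carrier V \<Longrightarrow> linmap V V (mode V a t)"
  using nprod_right[of a] mult_right[of "div_transl V (nat (- 1 - t)) a"]
  by (cases "t \<ge> 0") (simp_all add: mode_def[abs_def])

lemma mode_closed [simp]: "a \<in> carrier V \<Longrightarrow> b \<in> carrier V \<Longrightarrow> mode V a t b \<in> carrier V"
  using linmap.closed[OF mode_linmap] .

lemma mode_nat [simp]: "mode V a (int n) b = nprod V n a b"
  by (simp add: mode_def)

lemma mode_minus_one [simp]: "a \<in> carrier V \<Longrightarrow> mode V a (- 1) b = a \<otimes> b"
  by (simp add: mode_def)

text \<open>This is \<open>[T, Y(a)] = \<partial>\<^sub>z Y(a)\<close> in coefficients. For
  \<open>t > 0\<close> it merges \<open>transl_nprod\<close> with \<open>nprod_transl_Suc\<close>;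
  for \<open>t < 0\<close> it is the Leibniz rule for \<open>div_transl V n a \<otimes> b\<close>
  with \<open>t = - 1 - n\<close>. At \<open>t = 0\<close> the index \<open>t - 1\<close> falls into
  the other branch of \<open>mode\<close>, but its coefficient is zero.\<close>

lemma transl_mode:
  assumes a: "a \<in> carrier V" and b: "b \<in> carrier V"
  shows "transl V (mode V a t b) = (- of_int t) \<odot> mode V a (t - 1) b \<oplus> mode V a t (transl V b)"
proof (cases "t \<ge> 0")
  case True
  show ?thesis
  proof (cases "t = 0")
    case True
    then show ?thesis using assms nprod_transl_0 transl_nprod[OF a b, of 0] by (simp add: mode_def)
  next
    case False
    define n where "n = nat (t - 1)"
    with True False have "t = int (Suc n)" "nat t = Suc n" "nat (t - 1) = n" by auto
    with True False show ?thesis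
      using transl_nprod[OF a b, of "Suc n"] nprod_transl_Suc[OF a b, of n]
      by (simp add: mode_def del: of_nat_Suc)
  qed
next
  case False
  define n where "n = nat (- 1 - t)"
  then have n: "t = - int (Suc n)" "nat (- 1 - t) = n" "nat (- 1 - (t - 1)) = Suc n"
    using False by auto
  have "- (of_int t) = (of_nat (Suc n) :: 'k)" using n(1) by simp
  then show ?thesis using False n assms
    by (simp add: mode_def transl_mult transl_div_transl linmap.sm[OF mult_left] del: of_nat_Suc)
qed

end

text \<open>Let \<open>e0\<close>, \<open>e1\<close> be the components of \<one>. For homogeneous
  \<open>x\<close> of parity \<open>p\<close>, the equation \<open>x = e0 x + e1 x\<close> compares
  vectors of parity \<open>p\<close> and \<open>1 + p\<close>, so \<open>e1 x = 0\<close>. Hence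
  \<open>e1 = e1 \<one> = e1 e0 + e1 e1 = 0\<close>.\<close>

lemma (in unital_vertex_algebra) one_grade: "\<one> \<in> grade V 0"
proof -
  obtain e0 e1 where e: "e0 \<in> grade V 0" "e1 \<in> grade V 1" "\<one> = e0 \<oplus> e1"
    using grade_decomp[OF one_carrier] .
  have "e1 \<otimes> x = \<zero>" if x: "x \<in> grade V p" for p x
  proof -
    have g: "e0 \<otimes> x \<in> grade V p" "e1 \<otimes> x \<in> grade V (1 + p)"
      using mult_grade[OF e(1) x] mult_grade[OF e(2) x] by (simp_all only: add_0)
    have "x = e0 \<otimes> x \<oplus> e1 \<otimes> x"
      using one_left[of x] x e linmap.add[OF mult_left, of x e0 e1] by simp
    then have "e0 \<otimes> x \<oplus> e1 \<otimes> x \<oplus> \<ominus> x = \<zero>"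
      using x by (metis M.r_neg grade_closed)
    then have "e0 \<otimes> x \<ominus> x \<oplus> e1 \<otimes> x = \<zero>"
      using x e(1,2) by (simp add: a_minus_def M.add.m_ac)
    moreover have "e0 \<otimes> x \<ominus> x \<in> grade V p"
      using g x grade_add grade_neg by (auto simp: a_minus_def)
    moreover have "p \<noteq> 1 + p" by (cases p) auto
    ultimately show ?thesis using grade_sum_zero g(2) by blast
  qed
  then have "e1 \<otimes> e0 = \<zero>" "e1 \<otimes> e1 = \<zero>" using e by auto
  then have "e1 = \<zero>"
    using one_right[of e1] e linmap.add[OF mult_right, of e1 e0 e1] by simp
  then show ?thesis using e by simp
qed

text \<open>The Leibniz rule for \<open>\<one> \<otimes> \<one>\<close> gives
  \<open>T \<one> = T \<one> + T \<one>\<close>.\<close>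

lemma (in unital_vertex_algebra) transl_one: "transl V \<one> = \<zero>"
  using transl_mult[OF one_carrier one_carrier] one_carrier one_left one_right
  by (metis M.add.l_cancel_one transl_closed)

text \<open>Inserting \<open>T \<one> = 0\<close> into \<open>nprod_transl_Suc\<close> shows that
  \<open>- (n + 1)\<close> times the product vanishes, and this factor is invertible in
  characteristic 0.\<close>

lemma (in unital_vertex_algebra) nprod_one_left:
  assumes "x \<in> carrier V" shows "nprod V n \<one> x = \<zero>"
proof -
  have "(- of_nat (Suc n) :: 'k) \<odot> nprod V n \<one> x = \<zero>"
    using nprod_transl_Suc[OF one_carrier assms, of n] linmap.zero[OF nprod_left[OF assms]]
    by (simp add: transl_one)
  then show ?thesis
    using sm_eq_zeroD[of "nprod V n \<one> x" "- of_nat (Suc n)"] assms one_carrier by (simp del: of_nat_Suc)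
qed

section \<open>Equivariant maps are morphisms\<close>

lemma zeta_nonzero [simp]: "zeta p q \<noteq> 0"
  by (simp add: zeta_def)

lemma (in lie_superalgebra) lie_action_linmaps:
  assumes "lie_action g V \<rho>" "superspace V"
  shows "x \<in> carrier g \<Longrightarrow> linmap V V (\<rho> x)" "v \<in> carrier V \<Longrightarrow> linmap g V (\<lambda>x. \<rho> x v)"
    "x \<in> grade g p \<Longrightarrow> v \<in> grade V q \<Longrightarrow> \<rho> x v \<in> grade V (p + q)"
proof -
  have bil: "even_bilinear g V V \<rho>" using assms(1) by (simp add: lie_action_def)
  note sp = superspace_axioms assms(2) assms(2)
  show "x \<in> carrier g \<Longrightarrow> linmap V V (\<rho> x)" "v \<in> carrier V \<Longrightarrow> linmap g V (\<lambda>x. \<rho> x v)"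
    "x \<in> grade g p \<Longrightarrow> v \<in> grade V q \<Longrightarrow> \<rho> x v \<in> grade V (p + q)"
    using even_bilinear_right[OF sp bil] even_bilinear_left[OF sp bil] even_bilinear_grade[OF sp bil]
    by blast+
qed

context
  fixes g :: "('k::field_char_0, 'g, 'l) local_lie_algebra_scheme"
    and V :: "('k, 'v, 'g, 'm) vertex_algebra_over_scheme"
  assumes V: "assoc_unital_vertex_algebra_over g V"
begin

interpretation unital_vertex_algebra V
  using V by (simp add: assoc_unital_vertex_algebra_over_def)

text \<open>If \<open>a(z) = Y(u)\<close>, then \<open>u = u \<one>\<close> is the mode
  \<open>-1\<close> of \<open>u\<close> applied to \<one>. So the vector that represents a
  generating field is unique and given by the same formula in every \<open>V\<close>.\<close>

lemma gen_field_act: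
  assumes a: "a \<in> gen_fields g"
  shows "act V (a (- 1)) \<one>\<^bsub>V\<^esub> \<in> carrier V"
    and "v \<in> carrier V \<Longrightarrow> act V (a t) v = mode V (act V (a (- 1)) \<one>\<^bsub>V\<^esub>) t v"
proof -
  obtain u where u: "u \<in> carrier V" "\<And>t v. v \<in> carrier V \<Longrightarrow> act V (a t) v = mode V u t v"
    using V a unfolding assoc_unital_vertex_algebra_over_def vertex_algebra_over_def by blast
  then have "act V (a (- 1)) \<one>\<^bsub>V\<^esub> = u"
    using one_carrier one_right by simp
  with u show "act V (a (- 1)) \<one>\<^bsub>V\<^esub> \<in> carrier V"
    "v \<in> carrier V \<Longrightarrow> act V (a t) v = mode V (act V (a (- 1)) \<one>\<^bsub>V\<^esub>) t v" by auto
qed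

end

text \<open>\<open>f\<close> is any \<open>g\<close>-linear map that preserves the identity, and
  \<open>generated\<close> says that \<one> generates \<open>V\<close> as a \<open>g\<close>-module.
  Compatibility with parity, \<open>T\<close> and all products is deduced from this, without
  reference to the coset construction of \<open>V(g)\<close>.\<close>

locale equivariant_map =
  g: local_lie_algebra g +
  V: associative_vertex_algebra V + V: unital_vertex_algebra V +
  W: associative_vertex_algebra W + W: unital_vertex_algebra W +
  f: linmap V W f
  for g :: "('k::field_char_0, 'g, 'l) local_lie_algebra_scheme"
    and V :: "('k, 'v, 'g, 'm) vertex_algebra_over_scheme"
    and W :: "('k, 'w, 'g, 'n) vertex_algebra_over_scheme"
    and f :: "'v \<Rightarrow> 'w" +
  assumes V_over: "vertex_algebra_over g V"
    and W_over: "vertex_algebra_over g W"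
    and f_act: "x \<in> carrier g \<Longrightarrow> v \<in> carrier V \<Longrightarrow> f (act V x v) = act W x (f v)"
    and f_one: "f \<one>\<^bsub>V\<^esub> = \<one>\<^bsub>W\<^esub>"
    and generated: "submodule S scalars V \<Longrightarrow> \<one>\<^bsub>V\<^esub> \<in> S \<Longrightarrow>
      (\<And>x v. x \<in> carrier g \<Longrightarrow> v \<in> S \<Longrightarrow> act V x v \<in> S) \<Longrightarrow> carrier V \<subseteq> S"
begin

lemma over: "assoc_unital_vertex_algebra_over g V" "assoc_unital_vertex_algebra_over g W"
  using V_over W_over V.associative_vertex_algebra_axioms V.unital_vertex_algebra_axioms
    W.associative_vertex_algebra_axioms W.unital_vertex_algebra_axioms
  by (simp_all add: assoc_unital_vertex_algebra_over_def)

lemma V_action: "lie_action g V (act V)" and W_action: "lie_action g W (act W)"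
  using V_over W_over by (simp_all add: vertex_algebra_over_def)

lemmas act_V = g.lie_action_linmaps[OF V_action V.superspace_axioms]
lemmas act_W = g.lie_action_linmaps[OF W_action W.superspace_axioms]

lemma act_V_closed [simp]: "x \<in> carrier g \<Longrightarrow> v \<in> carrier V \<Longrightarrow> act V x v \<in> carrier V"
  using linmap.closed[OF act_V(1)] .

text \<open>Words of homogeneous modes applied to \<one> are homogeneous and span \<open>V\<close>.
  So linear conditions \<open>Q p\<close> on vectors of parity \<open>p\<close> propagate from
  \<one> along such modes: the sum \<open>S\<close> of the spaces \<open>Q 0\<close> and
  \<open>Q 1\<close> is stable under all of \<open>g\<close>.\<close>

lemma graded_induct:
  assumes Q_grade: "\<And>p x. Q p x \<Longrightarrow> x \<in> grade V p"
    and Q_zero: "\<And>p. Q p \<zero>\<^bsub>V\<^esub>"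
    and Q_add: "\<And>p x y. Q p x \<Longrightarrow> Q p y \<Longrightarrow> Q p (x \<oplus>\<^bsub>V\<^esub> y)"
    and Q_sm: "\<And>p c x. Q p x \<Longrightarrow> Q p (c \<odot>\<^bsub>V\<^esub> x)"
    and Q_one: "Q 0 \<one>\<^bsub>V\<^esub>"
    and Q_act: "\<And>a p q t v. a \<in> gen_fields g \<Longrightarrow> (\<And>t. a t \<in> grade g p) \<Longrightarrow> Q q v \<Longrightarrow>
      Q (p + q) (act V (a t) v)"
    and x: "x \<in> grade V p"
  shows "Q p x"
proof -
  define S where "S = {x0 \<oplus>\<^bsub>V\<^esub> x1 |x0 x1. Q 0 x0 \<and> Q 1 x1}"
  have carr: "Q p y \<Longrightarrow> y \<in> carrier V" for p y using Q_grade V.grade_closed by blast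
  have QS: "y \<in> S" if "Q p y" for p y
  proof (cases p)
    case zero
    have "y = y \<oplus>\<^bsub>V\<^esub> \<zero>\<^bsub>V\<^esub>" using carr[OF that] by simp
    then show ?thesis using that Q_zero[of 1] zero unfolding S_def by blast
  next
    case one
    have "y = \<zero>\<^bsub>V\<^esub> \<oplus>\<^bsub>V\<^esub> y" using carr[OF that] by simp
    then show ?thesis using that Q_zero[of 0] one unfolding S_def by blast
  qed
  have S_add: "x \<oplus>\<^bsub>V\<^esub> y \<in> S" if xy: "x \<in> S" "y \<in> S" for x y
  proof -
    obtain x0 x1 y0 y1 where
      *: "Q 0 x0" "Q 1 x1" "x = x0 \<oplus>\<^bsub>V\<^esub> x1" "Q 0 y0" "Q 1 y1" "y = y0 \<oplus>\<^bsub>V\<^esub> y1"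
      using xy unfolding S_def by blast
    then have "x \<oplus>\<^bsub>V\<^esub> y = (x0 \<oplus>\<^bsub>V\<^esub> y0) \<oplus>\<^bsub>V\<^esub> (x1 \<oplus>\<^bsub>V\<^esub> y1)"
      using carr by (simp add: V.M.add.m_ac)
    then show ?thesis using * Q_add unfolding S_def by blast
  qed
  have S_sub: "submodule S scalars V"
  proof (rule V.subspaceI)
    show "S \<subseteq> carrier V" unfolding S_def using carr by auto
    show "\<zero>\<^bsub>V\<^esub> \<in> S" using QS Q_zero by blast
  next
    fix c x assume "x \<in> S"
    then obtain x0 x1 where *: "Q 0 x0" "Q 1 x1" "x = x0 \<oplus>\<^bsub>V\<^esub> x1"
      unfolding S_def by blast
    then have "c \<odot>\<^bsub>V\<^esub> x = c \<odot>\<^bsub>V\<^esub> x0 \<oplus>\<^bsub>V\<^esub> c \<odot>\<^bsub>V\<^esub> x1"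
      using carr by (simp add: V.sm_add_right)
    then show "c \<odot>\<^bsub>V\<^esub> x \<in> S" using * Q_sm unfolding S_def by blast
  qed (rule S_add)
  note S = V.subspaceD[OF S_sub]
  \<comment> \<open>The stabiliser of \<open>S\<close> is a subspace of \<open>g\<close>, so it is
    enough that it contains the modes of homogeneous generating fields; every generating field is a
    sum of two of these.\<close>
  define H where "H = {x \<in> carrier g. \<forall>v\<in>S. act V x v \<in> S}"
  have hom: "a t \<in> H" if a: "a \<in> gen_fields g" "\<And>t. a t \<in> grade g p" for a p t
  proof -
    have "act V (a t) v \<in> S" if v: "v \<in> S" for v
    proof -
      obtain v0 v1 where *: "Q 0 v0" "Q 1 v1" "v = v0 \<oplus>\<^bsub>V\<^esub> v1"
        using v unfolding S_def by blast
      then have "act V (a t) v = act V (a t) v0 \<oplus>\<^bsub>V\<^esub> act V (a t) v1"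
        using linmap.add[OF act_V(1)] carr g.gen_fields_carrier[OF a(1)] by auto
      then show ?thesis using Q_act[OF a] QS S_add * by metis
    qed
    then show ?thesis using g.gen_fields_carrier[OF a(1)] by (simp add: H_def)
  qed
  have H_sub: "submodule H scalars g"
  proof (rule g.subspaceI)
    show "\<zero>\<^bsub>g\<^esub> \<in> H"
      using linmap.zero[OF act_V(2)] S by (auto simp: H_def)
    fix x y assume "x \<in> H" "y \<in> H"
    then show "x \<oplus>\<^bsub>g\<^esub> y \<in> H"
      using linmap.add[OF act_V(2)] S unfolding H_def by (auto simp: subset_iff)
  next
    fix c x assume "x \<in> H"
    then show "c \<odot>\<^bsub>g\<^esub> x \<in> H"
      using linmap.sm[OF act_V(2)] S unfolding H_def by (auto simp: subset_iff)
  qed (auto simp: H_def)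
  have "a t \<in> H" if a: "a \<in> gen_fields g" for a t
  proof -
    obtain b c where bc: "b \<in> gen_fields g" "c \<in> gen_fields g"
      "\<And>t. b t \<in> grade g 0" "\<And>t. c t \<in> grade g 1" "\<And>t. a t = b t \<oplus>\<^bsub>g\<^esub> c t"
      using g.gen_fields_components[OF a] by blast
    then show ?thesis using hom g.subspaceD(3)[OF H_sub] by metis
  qed
  then have "carrier g \<subseteq> H"
    unfolding g.carrier_span by (intro lin_span_induct[OF H_sub]) auto
  then have "carrier V \<subseteq> S"
    using QS[OF Q_one] by (intro generated[OF S_sub]) (auto simp: H_def)
  then obtain x0 x1 where *: "Q 0 x0" "Q 1 x1" "x = x0 \<oplus>\<^bsub>V\<^esub> x1"
    using x V.grade_closed unfolding S_def by blast
  then have c: "x0 \<in> carrier V" "x1 \<in> carrier V" "x0 \<in> grade V 0" "x1 \<in> grade V 1"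
    using Q_grade V.grade_closed by blast+
  \<comment> \<open>The part of \<open>x\<close> of the other parity is a difference of two vectors
    of parity \<open>p\<close>, so it vanishes.\<close>
  show "Q p x"
  proof (cases p)
    case zero
    have "x \<ominus>\<^bsub>V\<^esub> x0 = x1" using *(3) c V.M.add.m_comm[of x0 x1] by (simp add: a_minus_def V.M.add.m_assoc V.M.r_neg)
    moreover have "x \<ominus>\<^bsub>V\<^esub> x0 \<in> grade V 0"
      using x zero c V.grade_add V.grade_neg by (auto simp: a_minus_def)
    ultimately have "x1 = \<zero>\<^bsub>V\<^esub>" using V.grade_unique[of x1 0 1] c by simp
    then show ?thesis using * c zero by simp
  next
    case one
    have "x \<ominus>\<^bsub>V\<^esub> x1 = x0" using *(3) c by (simp add: a_minus_def V.M.add.m_assoc V.M.r_neg)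
    moreover have "x \<ominus>\<^bsub>V\<^esub> x1 \<in> grade V 1"
      using x one c V.grade_add V.grade_neg by (auto simp: a_minus_def)
    ultimately have "x0 = \<zero>\<^bsub>V\<^esub>" using V.grade_unique[of x0 0 1] c by simp
    then show ?thesis using * c one by simp
  qed
qed

text \<open>A word of homogeneous modes has the same parity whether it is applied to the even vector
  \<one> of \<open>V\<close> or to that of \<open>W\<close>.\<close>

lemma f_grade: "x \<in> grade V p \<Longrightarrow> f x \<in> grade W p"
proof -
  assume "x \<in> grade V p"
  then have "x \<in> grade V p \<and> f x \<in> grade W p"
  proof (rule graded_induct[rotated -1])
    fix a p q t v assume a: "a \<in> gen_fields g" "\<And>t. a t \<in> grade g p"
      and v: "v \<in> grade V q \<and> f v \<in> grade W q"
    then show "act V (a t) v \<in> grade V (p + q) \<and> f (act V (a t) v) \<in> grade W (p + q)"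
      using act_V(3)[OF a(2)] act_W(3)[OF a(2)] f_act[of "a t" v] g.gen_fields_carrier[OF a(1)]
        V.grade_closed by metis
  qed (auto simp: f.add f.sm V.grade_add W.grade_add V.grade_sm W.grade_sm f_one
      V.one_grade W.one_grade)
  then show ?thesis by simp
qed

text \<open>By \<open>transl_mode\<close>, moving \<open>T\<close> past a mode gives the same
  expression in modes on both sides; the induction starts from \<open>T \<one> = 0\<close>.\<close>

lemma f_transl:
  assumes "x \<in> carrier V" shows "f (transl V x) = transl W (f x)"
proof (rule linear_map_ext[OF _ _ V.superspace_axioms _ assms])
  show "linmap V W (\<lambda>x. f (transl V x))" "linmap V W (\<lambda>x. transl W (f x))"
    using linmap_comp[OF V.transl_linmap f.linmap_axioms] linmap_comp[OF f.linmap_axioms W.transl_linmap]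
    by auto
  fix p x assume "x \<in> grade V p"
  then have "x \<in> grade V p \<and> f (transl V x) = transl W (f x)"
  proof (rule graded_induct[rotated -1])
    fix a p q t v assume a: "a \<in> gen_fields g" "\<And>t. a t \<in> grade g p"
      and v: "v \<in> grade V q \<and> f (transl V v) = transl W (f v)"
    have c: "v \<in> carrier V" "f v \<in> carrier W" using v by auto
    note ac = g.gen_fields_carrier[OF a(1)]
    have *: "transl V (act V (a t) v) = (- of_int t) \<odot>\<^bsub>V\<^esub> act V (a (t - 1)) v \<oplus>\<^bsub>V\<^esub> act V (a t) (transl V v)"
      using V.transl_mode[OF gen_field_act(1)[OF over(1) a(1)]] c
      by (simp add: gen_field_act(2)[OF over(1) a(1)])
    have **: "transl W (act W (a t) (f v)) = (- of_int t) \<odot>\<^bsub>W\<^esub> act W (a (t - 1)) (f v) \<oplus>\<^bsub>W\<^esub> act W (a t) (transl W (f v))"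
      using W.transl_mode[OF gen_field_act(1)[OF over(2) a(1)]] c
      by (simp add: gen_field_act(2)[OF over(2) a(1)])
    show "act V (a t) v \<in> grade V (p + q) \<and> f (transl V (act V (a t) v)) = transl W (f (act V (a t) v))"
      using v c ac act_V(3)[OF a(2)] by (simp add: f_act * ** f.add f.sm)
  qed (auto simp: f.add f.sm V.grade_add V.grade_sm f_one V.one_grade
      V.transl_one W.transl_one linmap.add[OF V.transl_linmap] linmap.add[OF W.transl_linmap]
      linmap.sm[OF V.transl_linmap] linmap.sm[OF W.transl_linmap]
      linmap.zero[OF V.transl_linmap] linmap.zero[OF W.transl_linmap])
  then show "f (transl V x) = transl W (f x)" by simp
qed

section \<open>Multiplicativity of an equivariant map\<close>

lemma f_div_transl: "x \<in> carrier V \<Longrightarrow> f (div_transl V n x) = div_transl W n (f x)"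
proof -
  assume x: "x \<in> carrier V"
  then have "f ((transl V ^^ n) x) = (transl W ^^ n) (f x)"
    by (induction n) (auto simp: f_transl)
  then show ?thesis using x by (simp add: div_transl_def f.sm)
qed

text \<open>Skew-symmetry writes \<open>a_n b\<close> through divided powers of \<open>T\<close>
  applied to the products \<open>b_j a\<close>, and \<open>f\<close> commutes with
  \<open>T\<close>.\<close>

lemma f_nprod_swap:
  assumes a: "a \<in> grade V p" and b: "b \<in> grade V q"
    and ba: "\<And>j. f (nprod V j b a) = nprod W j (f b) (f a)"
  shows "f (nprod V n a b) = nprod W n (f a) (f b)"
proof -
  let ?J = "{j. nprod V (n + j) b a \<noteq> \<zero>\<^bsub>V\<^esub>}"
  let ?K = "{j. nprod W (n + j) (f b) (f a) \<noteq> \<zero>\<^bsub>W\<^esub>}"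
  have c: "a \<in> carrier V" "b \<in> carrier V" using a b by auto
  have "finite ((+) n -` {j. nprod V j b a \<noteq> \<zero>\<^bsub>V\<^esub>})"
    by (intro finite_vimageI V.nprod_finite c) simp
  then have fin: "finite ?J" by (simp add: vimage_def)
  \<comment> \<open>\<open>f\<close> may kill a nonzero product, so the formulas in \<open>V\<close>
    and \<open>W\<close> sum over different index sets; the surplus terms in \<open>?J\<close> are
    zero.\<close>
  have KJ: "?K \<subseteq> ?J" by (auto simp flip: ba)
  have "f (nprod V n a b) = \<ominus>\<^bsub>W\<^esub> (zeta p q \<odot>\<^bsub>W\<^esub> (\<Oplus>\<^bsub>W\<^esub>j\<in>?J.
      (- 1) ^ (n + j) \<odot>\<^bsub>W\<^esub> div_transl W j (nprod W (n + j) (f b) (f a))))"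
    unfolding V.lambda_skew[OF a b, of n] using c
    by (simp add: f.neg f.sm f.sum f_div_transl ba)
  also have "(\<Oplus>\<^bsub>W\<^esub>j\<in>?J. (- 1) ^ (n + j) \<odot>\<^bsub>W\<^esub> div_transl W j (nprod W (n + j) (f b) (f a))) =
     (\<Oplus>\<^bsub>W\<^esub>j\<in>?K. (- 1) ^ (n + j) \<odot>\<^bsub>W\<^esub> div_transl W j (nprod W (n + j) (f b) (f a)))"
    by (rule W.M.add.finprod_mono_neutral_cong_right[OF fin KJ]) (use c in auto)
  finally show ?thesis using W.lambda_skew[OF f_grade[OF a] f_grade[OF b], of n] by simp
qed

text \<open>The commutator formula involves only \<open>T\<close> and the products
  \<open>a_i b\<close>, so the value of \<open>f\<close> on the commutator is known even while
  \<open>f (a \<otimes> b)\<close> is not.\<close>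

lemma f_super_commutator:
  assumes a: "a \<in> grade V p" and b: "b \<in> grade V q"
    and ab: "\<And>j. f (nprod V j a b) = nprod W j (f a) (f b)"
  shows "f (super_commutator V p q a b) = super_commutator W p q (f a) (f b)"
proof -
  let ?J = "{j. nprod V j a b \<noteq> \<zero>\<^bsub>V\<^esub>}"
  let ?K = "{j. nprod W j (f a) (f b) \<noteq> \<zero>\<^bsub>W\<^esub>}"
  have c: "a \<in> carrier V" "b \<in> carrier V" using a b by auto
  have fin: "finite ?J" by (intro V.nprod_finite c)
  have KJ: "?K \<subseteq> ?J" by (auto simp flip: ab)
  have "f (super_commutator V p q a b) = (\<Oplus>\<^bsub>W\<^esub>i\<in>?J.
      (- 1) ^ i \<odot>\<^bsub>W\<^esub> div_transl W (Suc i) (nprod W i (f a) (f b)))"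
    unfolding V.commutator_formula[OF a b] using c
    by (simp add: f.neg f.sm f.sum f_div_transl ab)
  also have "\<dots> = (\<Oplus>\<^bsub>W\<^esub>i\<in>?K. (- 1) ^ i \<odot>\<^bsub>W\<^esub> div_transl W (Suc i) (nprod W i (f a) (f b)))"
    by (rule W.M.add.finprod_mono_neutral_cong_right[OF fin KJ]) (use c in auto)
  finally show ?thesis using W.commutator_formula[OF f_grade[OF a] f_grade[OF b]] by simp
qed

text \<open>Once the commutator and one of its two terms are known, the other follows, as the sign
  \<open>zeta p q\<close> is invertible.\<close>

lemma f_mult_swap:
  assumes a: "a \<in> grade V p" and b: "b \<in> grade V q"
    and ab: "\<And>j. f (nprod V j a b) = nprod W j (f a) (f b)"
    and m: "f (a \<otimes>\<^bsub>V\<^esub> b) = f a \<otimes>\<^bsub>W\<^esub> f b"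
  shows "f (b \<otimes>\<^bsub>V\<^esub> a) = f b \<otimes>\<^bsub>W\<^esub> f a"
proof -
  have c: "a \<in> carrier V" "b \<in> carrier V" using a b by auto
  have "f (a \<otimes>\<^bsub>V\<^esub> b) \<ominus>\<^bsub>W\<^esub> zeta p q \<odot>\<^bsub>W\<^esub> f (b \<otimes>\<^bsub>V\<^esub> a) =
      f a \<otimes>\<^bsub>W\<^esub> f b \<ominus>\<^bsub>W\<^esub> zeta p q \<odot>\<^bsub>W\<^esub> (f b \<otimes>\<^bsub>W\<^esub> f a)"
    using f_super_commutator[OF a b ab] c unfolding super_commutator_def
    by (simp add: f.minus f.sm)
  then show ?thesis unfolding m using c by (simp add: W.minus_left_cancel W.sm_cancel)
qed

text \<open>No homogeneity is demanded of \<open>x\<close>, so that these vectors form a subspace;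
  \<open>y\<close> ranges over the whole carrier, so that nested products can be unwound from the
  outside.\<close>

definition left_hom :: "'v \<Rightarrow> bool" where
  "left_hom x \<longleftrightarrow> x \<in> carrier V \<and> (\<forall>y\<in>carrier V.
     f (x \<otimes>\<^bsub>V\<^esub> y) = f x \<otimes>\<^bsub>W\<^esub> f y \<and> (\<forall>n. f (nprod V n x y) = nprod W n (f x) (f y)))"

lemma left_homD:
  assumes "left_hom x" "y \<in> carrier V"
  shows "f (x \<otimes>\<^bsub>V\<^esub> y) = f x \<otimes>\<^bsub>W\<^esub> f y" "f (nprod V n x y) = nprod W n (f x) (f y)"
  using assms by (auto simp: left_hom_def)

lemma left_homI:
  assumes x: "x \<in> carrier V"
    and "\<And>q y. y \<in> grade V q \<Longrightarrow> f (x \<otimes>\<^bsub>V\<^esub> y) = f x \<otimes>\<^bsub>W\<^esub> f y"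
    and "\<And>q y n. y \<in> grade V q \<Longrightarrow> f (nprod V n x y) = nprod W n (f x) (f y)"
  shows "left_hom x"
  unfolding left_hom_def
proof (intro conjI ballI allI x)
  fix y assume y: "y \<in> carrier V"
  show "f (x \<otimes>\<^bsub>V\<^esub> y) = f x \<otimes>\<^bsub>W\<^esub> f y"
    by (rule linear_map_ext[OF linmap_comp[OF V.mult_right f.linmap_axioms]
          linmap_comp[OF f.linmap_axioms W.mult_right] V.superspace_axioms]) (use x y assms in auto)
  show "f (nprod V n x y) = nprod W n (f x) (f y)" for n
    by (rule linear_map_ext[OF linmap_comp[OF V.nprod_right f.linmap_axioms]
          linmap_comp[OF f.linmap_axioms W.nprod_right] V.superspace_axioms]) (use x y assms in auto)
qed

text \<open>The swap lemmas move \<open>x\<close> to the other side for homogeneous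
  \<open>y\<close>, and linearity in \<open>y\<close> does the rest.\<close>

lemma right_homD:
  assumes "left_hom x" "x \<in> grade V p" "y \<in> carrier V"
  shows "f (y \<otimes>\<^bsub>V\<^esub> x) = f y \<otimes>\<^bsub>W\<^esub> f x" "f (nprod V n y x) = nprod W n (f y) (f x)"
proof -
  have x: "x \<in> carrier V" using assms by auto
  have 1: "f (nprod V n y x) = nprod W n (f y) (f x)" if "y \<in> grade V q" for y n q
    by (rule f_nprod_swap[OF that assms(2)]) (use that in \<open>auto intro: left_homD[OF assms(1)]\<close>)
  have 2: "f (y \<otimes>\<^bsub>V\<^esub> x) = f y \<otimes>\<^bsub>W\<^esub> f x" if "y \<in> grade V q" for y q
    by (rule f_mult_swap[OF assms(2) that]) (use that in \<open>auto intro: left_homD[OF assms(1)]\<close>)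
  show "f (y \<otimes>\<^bsub>V\<^esub> x) = f y \<otimes>\<^bsub>W\<^esub> f x"
    by (rule linear_map_ext[OF linmap_comp[OF V.mult_left f.linmap_axioms]
          linmap_comp[OF f.linmap_axioms W.mult_left] V.superspace_axioms 2]) (use x assms in auto)
  show "f (nprod V n y x) = nprod W n (f y) (f x)"
    by (rule linear_map_ext[OF linmap_comp[OF V.nprod_left f.linmap_axioms]
          linmap_comp[OF f.linmap_axioms W.nprod_left] V.superspace_axioms 1]) (use x assms in auto)
qed

lemma left_homI_right:
  assumes x: "x \<in> grade V p"
    and m: "\<And>q y. y \<in> grade V q \<Longrightarrow> f (y \<otimes>\<^bsub>V\<^esub> x) = f y \<otimes>\<^bsub>W\<^esub> f x"
    and n: "\<And>q y n. y \<in> grade V q \<Longrightarrow> f (nprod V n y x) = nprod W n (f y) (f x)"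
  shows "left_hom x"
proof (rule left_homI)
  fix q y n assume y: "y \<in> grade V q"
  show "f (nprod V n x y) = nprod W n (f x) (f y)" by (rule f_nprod_swap[OF x y n[OF y]])
  show "f (x \<otimes>\<^bsub>V\<^esub> y) = f x \<otimes>\<^bsub>W\<^esub> f y" by (rule f_mult_swap[OF y x n[OF y] m[OF y]])
qed (use x in auto)

lemma left_hom_add: "left_hom x \<Longrightarrow> left_hom y \<Longrightarrow> left_hom (x \<oplus>\<^bsub>V\<^esub> y)"
  unfolding left_hom_def
  by (auto simp: f.add linmap.add[OF V.mult_left] linmap.add[OF W.mult_left]
      linmap.add[OF V.nprod_left] linmap.add[OF W.nprod_left])

lemma left_hom_sm: "left_hom x \<Longrightarrow> left_hom (c \<odot>\<^bsub>V\<^esub> x)"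
  unfolding left_hom_def
  by (auto simp: f.sm linmap.sm[OF V.mult_left] linmap.sm[OF W.mult_left]
      linmap.sm[OF V.nprod_left] linmap.sm[OF W.nprod_left])

lemma left_hom_one: "left_hom \<one>\<^bsub>V\<^esub>"
  unfolding left_hom_def using V.one_carrier
  by (auto simp: f_one V.one_left W.one_left V.nprod_one_left W.nprod_one_left)

text \<open>Apply \<open>f\<close> to \<open>T (x y) = (T x) y + x (T y)\<close> and cancel the last
  term, which is known because the hypothesis on \<open>x\<close> covers the vector
  \<open>T y\<close>. The products \<open>(T x)_n y\<close> are zero or multiples of products with
  \<open>x\<close>.\<close>

lemma left_hom_transl:
  assumes x: "left_hom x" shows "left_hom (transl V x)"
proof (rule left_homI)
  show c: "transl V x \<in> carrier V" using x by (simp add: left_hom_def)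
  have xc: "x \<in> carrier V" using x by (simp add: left_hom_def)
  fix q y n assume "y \<in> grade V q"
  then have y: "y \<in> carrier V" by simp
  have "f (transl V x \<otimes>\<^bsub>V\<^esub> y) \<oplus>\<^bsub>W\<^esub> f x \<otimes>\<^bsub>W\<^esub> transl W (f y) =
      transl W (f x) \<otimes>\<^bsub>W\<^esub> f y \<oplus>\<^bsub>W\<^esub> f x \<otimes>\<^bsub>W\<^esub> transl W (f y)"
    using f_transl[of "x \<otimes>\<^bsub>V\<^esub> y"] xc y x
    by (simp add: V.transl_mult W.transl_mult left_homD f.add f_transl)
  then show "f (transl V x \<otimes>\<^bsub>V\<^esub> y) = f (transl V x) \<otimes>\<^bsub>W\<^esub> f y"
    using xc y by (simp add: f_transl)
  show "f (nprod V n (transl V x) y) = nprod W n (f (transl V x)) (f y)"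
    using xc y x V.nprod_transl_0[OF xc y] W.nprod_transl_0[of "f x" "f y"]
      V.nprod_transl_Suc[OF xc y] W.nprod_transl_Suc[of "f x" "f y"]
    by (cases n) (simp_all add: f_transl f.sm left_homD del: of_nat_Suc)
qed

text \<open>The axioms expand products with \<open>a b\<close> as the right factor, so the claim is
  proved on that side. Left symmetry turns \<open>y (a b)\<close> into \<open>[y, a] b\<close> and
  \<open>a (y b)\<close>, and the Wick formula expands \<open>y_n (a b)\<close>. In each resulting
  term every multiplication has \<open>a\<close> or \<open>b\<close> as a factor.\<close>

lemma left_hom_mult:
  assumes a: "left_hom a" "a \<in> grade V p" and b: "left_hom b" "b \<in> grade V q"
  shows "left_hom (a \<otimes>\<^bsub>V\<^esub> b)"
proof (rule left_homI_right)
  show "a \<otimes>\<^bsub>V\<^esub> b \<in> grade V (p + q)" using a b by (blast intro: V.mult_grade)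
  fix r y n assume y: "y \<in> grade V r"
  have c: "a \<in> carrier V" "b \<in> carrier V" "y \<in> carrier V" using a b y by auto
  note h = left_homD[OF a(1)] left_homD[OF b(1)] right_homD[OF a] right_homD[OF b]
  have "f (super_commutator V r p y a \<otimes>\<^bsub>V\<^esub> b) = super_commutator W r p (f y) (f a) \<otimes>\<^bsub>W\<^esub> f b"
    using c by (simp add: super_commutator_def h f.minus f.sm)
  then show "f (y \<otimes>\<^bsub>V\<^esub> (a \<otimes>\<^bsub>V\<^esub> b)) = f y \<otimes>\<^bsub>W\<^esub> f (a \<otimes>\<^bsub>V\<^esub> b)"
    using c unfolding V.left_symmetric[OF y a(2) c(2)]
      W.left_symmetric[OF f_grade[OF y] f_grade[OF a(2)] f.closed[OF c(2)]]
    by (simp add: f.minus f.sm h W.minus_right_cancel)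
  show "f (nprod V n y (a \<otimes>\<^bsub>V\<^esub> b)) = nprod W n (f y) (f (a \<otimes>\<^bsub>V\<^esub> b))"
    using c unfolding h(1)[OF c(2)] V.wick[OF y a(2) c(2)]
      W.wick[OF f_grade[OF y] f_grade[OF a(2)] f.closed[OF c(2)]]
    by (simp add: f.add f.sm f.sum h)
qed

text \<open>The Jacobi identity expands \<open>(a_m b)_n y\<close> into iterated products with
  \<open>a\<close> and \<open>b\<close> on the left. The product \<open>(a_m b) y\<close> comes from
  the Wick formula instead.\<close>

lemma left_hom_nprod:
  assumes a: "left_hom a" "a \<in> grade V p" and b: "left_hom b" "b \<in> grade V q"
  shows "left_hom (nprod V m a b)"
proof (rule left_homI)
  have c: "a \<in> carrier V" "b \<in> carrier V" using a b by auto
  then show "nprod V m a b \<in> carrier V" by simp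
  note h = left_homD[OF a(1)] left_homD[OF b(1)]
  have n: "f (nprod V n (nprod V m a b) y) = nprod W n (f (nprod V m a b)) (f y)"
    if y: "y \<in> carrier V" for m n y
    using c y unfolding h(2)[OF c(2)] V.lambda_jacobi[OF a(2) b(2) y]
      W.lambda_jacobi[OF f_grade[OF a(2)] f_grade[OF b(2)] f.closed[OF y]]
    by (simp add: f.sum f.minus f.sm h)
  fix r y k assume "y \<in> grade V r"
  then have y: "y \<in> carrier V" by simp
  show "f (nprod V k (nprod V m a b) y) = nprod W k (f (nprod V m a b)) (f y)"
    using n[OF y] .
  \<comment> \<open>The Wick formula for \<open>a_m (b y)\<close> is read backwards: this left-hand
    side, the term with \<open>b (a_m y)\<close> and the sum are all known, so the summand
    \<open>(a_m b) y\<close> follows by cancellation.\<close>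
  have "f (nprod V m a (b \<otimes>\<^bsub>V\<^esub> y)) = nprod W m (f a) (f b \<otimes>\<^bsub>W\<^esub> f y)"
    using c y by (simp add: h)
  then show "f (nprod V m a b \<otimes>\<^bsub>V\<^esub> y) = f (nprod V m a b) \<otimes>\<^bsub>W\<^esub> f y"
    using c y unfolding V.wick[OF a(2) b(2) y] W.wick[OF f_grade[OF a(2)] f_grade[OF b(2)] f.closed[OF y]]
    by (simp add: f.add f.sm f.sum h n W.M.add.m_assoc)
qed

lemma left_hom_mode:
  assumes a: "left_hom a" "a \<in> grade V p" and b: "left_hom b" "b \<in> grade V q"
  shows "left_hom (mode V a t b)"
proof (cases "t \<ge> 0")
  case False
  have "left_hom ((transl V ^^ n) a)" for n
    using a(1) by (induction n) (auto intro: left_hom_transl)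
  then have "left_hom (div_transl V n a)" for n
    by (simp add: div_transl_def left_hom_sm)
  with False show ?thesis
    using left_hom_mult[OF _ V.div_transl_grade[OF a(2)] b] by (simp add: mode_def)
qed (use left_hom_nprod[OF assms] in \<open>simp add: mode_def\<close>)

text \<open>\<open>f\<close> sends the vector of \<open>a(z)\<close> in \<open>V\<close> to the
  vector of \<open>a(z)\<close> in \<open>W\<close>, so equivariance says that \<open>f\<close>
  intertwines all their modes. The mode \<open>-1\<close> gives the product, the modes
  \<open>t \<ge> 0\<close> the \<open>\<lambda>\<close>-bracket.\<close>

lemma left_hom_gen_field:
  assumes a: "a \<in> gen_fields g" shows "left_hom (act V (a (- 1)) \<one>\<^bsub>V\<^esub>)"
proof -
  let ?u = "act V (a (- 1)) \<one>\<^bsub>V\<^esub>"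
  note u = gen_field_act(1)[OF over(1) a]
  have fu: "f ?u = act W (a (- 1)) \<one>\<^bsub>W\<^esub>"
    using f_act V.one_carrier g.gen_fields_carrier[OF a] by (simp add: f_one)
  have *: "f (mode V ?u t y) = mode W (f ?u) t (f y)" if "y \<in> carrier V" for t y
    using f_act[of "a t" y] g.gen_fields_carrier[OF a] that
      gen_field_act(2)[OF over(1) a] gen_field_act(2)[OF over(2) a]
    by (simp add: fu)
  show ?thesis unfolding left_hom_def
  proof (intro conjI ballI allI u)
    fix y assume y: "y \<in> carrier V"
    show "f (?u \<otimes>\<^bsub>V\<^esub> y) = f ?u \<otimes>\<^bsub>W\<^esub> f y"
      using *[OF y, of "-1"] u by simp
    show "f (nprod V n ?u y) = nprod W n (f ?u) (f y)" for n
      using *[OF y, of "int n"] by simp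
  qed
qed

text \<open>Applying \<open>a t\<close> amounts to taking a mode of the vector of
  \<open>a(z)\<close>, so \<open>left_hom_mode\<close> provides the induction step.\<close>

lemma left_hom: "x \<in> grade V p \<Longrightarrow> left_hom x"
proof -
  assume "x \<in> grade V p"
  then have "x \<in> grade V p \<and> left_hom x"
  proof (rule graded_induct[rotated -1])
    fix a p q t v assume a: "a \<in> gen_fields g" "\<And>t. a t \<in> grade g p" and v: "v \<in> grade V q \<and> left_hom v"
    have "act V (a (- 1)) \<one>\<^bsub>V\<^esub> \<in> grade V (p + 0)"
      using act_V(3)[OF a(2) V.one_grade] .
    then have "left_hom (mode V (act V (a (- 1)) \<one>\<^bsub>V\<^esub>) t v)"
      using left_hom_mode[OF left_hom_gen_field[OF a(1)]] v by blast
    then show "act V (a t) v \<in> grade V (p + q) \<and> left_hom (act V (a t) v)"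
      using gen_field_act(2)[OF over(1) a(1)] act_V(3)[OF a(2)] v V.grade_closed by metis
  next
    show "\<zero>\<^bsub>V\<^esub> \<in> grade V p \<and> left_hom \<zero>\<^bsub>V\<^esub>" for p
      using left_hom_sm[OF left_hom_one, of 0] V.one_carrier by simp
  qed (auto simp: V.grade_add V.grade_sm left_hom_add left_hom_sm left_hom_one V.one_grade)
  then show ?thesis by simp
qed

text \<open>Morphisms are extensional by definition, so \<open>f\<close> is cut down to the carrier,
  where its values are unchanged.\<close>

theorem restrict_morphism: "unital_vertex_algebra_over_morphism g V W (restrict f (carrier V))"
proof -
  have l: "left_hom x" if x: "x \<in> carrier V" for x
    using V.grade_decomp[OF x] left_hom left_hom_add by metis
  have "linear_map V W (restrict f (carrier V))"
    by (auto simp: linear_map_def f.add f.sm)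
  then show ?thesis
    unfolding unital_vertex_algebra_over_morphism_def unital_vertex_algebra_morphism_def even_linear_def
    by (auto simp: f_grade f_transl left_homD[OF l] f_one V.one_carrier f_act)
qed

end

section \<open>Quotients and linear extensions\<close>

context vspace
begin

lemma subspace_abelian_subgroup:
  assumes "submodule H scalars M" shows "abelian_subgroup H M"
  using submodule.axioms(1)[OF assms]
  by (intro abelian_subgroupI3 additive_subgroupI M.abelian_group_axioms)

context
  fixes H assumes H: "submodule H scalars M"
begin

interpretation abelian_subgroup H M
  by (rule subspace_abelian_subgroup[OF H])

lemma coset_mem_iff: "x \<in> carrier M \<Longrightarrow> y \<in> H +> x \<longleftrightarrow> y \<in> carrier M \<and> y \<ominus> x \<in> H"
  using a_rcos_module[of x y] a_elemrcos_carrier[of x y] by (auto simp: a_minus_def)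

lemma coset_eq_iff: "x \<in> carrier M \<Longrightarrow> y \<in> carrier M \<Longrightarrow> H +> x = H +> y \<longleftrightarrow> x \<ominus> y \<in> H"
  using a_repr_independence'[of x y] a_repr_independenceD[of x y] coset_mem_iff[of y x]
  by auto

lemma coset_self: "x \<in> carrier M \<Longrightarrow> x \<in> H +> x"
  by (rule a_rcos_self)

text \<open>Cosets are disjoint or equal. This serves operations defined as unions over
  representatives, which at first are only known to contain a certain coset.\<close>

lemma coset_mono_eq:
  assumes "x \<in> carrier M" "y \<in> carrier M" "H +> x \<subseteq> H +> y"
  shows "H +> x = H +> y"
  using a_repr_independence'[of x y] assms coset_self[of x] by blast

lemma coset_zero: "H +> \<zero> = H"
  using a_rcos_const[of \<zero>] by simp

lemma coset_add: "x \<in> carrier M \<Longrightarrow> y \<in> carrier M \<Longrightarrow> set_add M (H +> x) (H +> y) = H +> (x \<oplus> y)"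
  by (rule a_rcos_sum)

text \<open>Operations on quotients are defined as unions over representatives; when all of these
  give the same value, the union collapses to it.\<close>

lemma coset_Union:
  assumes "x \<in> carrier M" "\<And>y. y \<in> H +> x \<Longrightarrow> G y = G x"
  shows "(\<Union>y\<in>H +> x. G y) = G x"
  using assms coset_self by blast

lemma coset_smult:
  assumes x: "x \<in> carrier M"
  shows "(\<Union>y\<in>H +> x. H +> ((c::'k) \<odot> y)) = H +> (c \<odot> x)"
proof (rule coset_Union[OF x])
  fix y assume "y \<in> H +> x"
  then have y: "y \<in> carrier M" "y \<ominus> x \<in> H" using coset_mem_iff[OF x] by auto
  then have "c \<odot> y \<ominus> c \<odot> x = c \<odot> (y \<ominus> x)"
    using x by (simp add: a_minus_def sm_add_right sm_minus_right)
  then show "H +> c \<odot> y = H +> c \<odot> x"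
    using y x subspaceD(4)[OF H] coset_eq_iff[of "c \<odot> y" "c \<odot> x"] by simp
qed

end

end

lemma a_rcosetsE:
  assumes "C \<in> a_rcosets\<^bsub>M\<^esub> H"
  obtains x where "x \<in> carrier M" "C = H +>\<^bsub>M\<^esub> x"
  using assms by (auto simp: A_RCOSETS_def')

text \<open>A linear map that kills \<open>H\<close> is constant on cosets, so evaluation at a
  chosen representative is the induced map on the quotient.\<close>

lemma (in linmap) some_coset_rep:
  assumes H: "submodule H scalars V" "\<And>y. y \<in> H \<Longrightarrow> f y = \<zero>\<^bsub>W\<^esub>" and x: "x \<in> carrier V"
  shows "f (SOME y. y \<in> H +>\<^bsub>V\<^esub> x) = f x"
proof -
  have "(SOME y. y \<in> H +>\<^bsub>V\<^esub> x) \<in> H +>\<^bsub>V\<^esub> x"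
    using V.coset_self[OF H(1) x] by (rule someI)
  then have "(SOME y. y \<in> H +>\<^bsub>V\<^esub> x) \<in> carrier V" "f ((SOME y. y \<in> H +>\<^bsub>V\<^esub> x) \<ominus>\<^bsub>V\<^esub> x) = \<zero>\<^bsub>W\<^esub>"
    using V.coset_mem_iff[OF H(1) x] H(2) by auto
  then show ?thesis using x by (simp add: minus W.minus_eq_zero_iff)
qed

section \<open>Finitely supported functions and linear extension\<close>

lemma lookup_scale [simp]: "Poly_Mapping.lookup (Poly_Mapping.map ((*) c) p) u = (c::'k::field) * Poly_Mapping.lookup p u"
  by (simp add: map.rep_eq when_def)

lemma poly_mapping_induct_keys [consumes 1, case_names zero single add]:
  assumes "Poly_Mapping.keys p \<subseteq> A" and "P 0"
    and "\<And>u c. u \<in> A \<Longrightarrow> P (Poly_Mapping.single u c)"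
    and "\<And>p q. Poly_Mapping.keys p \<subseteq> A \<Longrightarrow> Poly_Mapping.keys q \<subseteq> A \<Longrightarrow> P p \<Longrightarrow> P q \<Longrightarrow> P (p + q)"
  shows "P p"
  using assms(1)
proof (induction "card (Poly_Mapping.keys p)" arbitrary: p)
  case 0
  then show ?case using assms(2) by simp
next
  case (Suc n)
  then obtain u where u: "u \<in> Poly_Mapping.keys p" by (metis card.empty equals0I nat.distinct(1))
  \<comment> \<open>Splitting off the monomial at \<open>u\<close> lowers the number of keys, on
    which the induction runs.\<close>
  define q where "q = Poly_Mapping.update u 0 p"
  have k: "Poly_Mapping.keys q = Poly_Mapping.keys p - {u}"
    by (auto simp: q_def in_keys_iff lookup_update split: if_splits)
  have p: "p = q + Poly_Mapping.single u (Poly_Mapping.lookup p u)"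
    by (rule poly_mapping_eqI) (auto simp: q_def lookup_update lookup_add lookup_single when_def)
  have "P q" using Suc u k by (intro Suc.hyps(1)) auto
  then have "P (q + Poly_Mapping.single u (Poly_Mapping.lookup p u))"
    using Suc.prems u k assms(3)[of u] by (intro assms(4)) auto
  then show ?case using p by simp
qed

lemmas poly_mapping_induct_single [case_names zero single add] =
  poly_mapping_induct_keys[OF subset_UNIV]

text \<open>Covers both the free algebra, with the words as basis, and \<open>pair_space\<close>,
  with the pairs as basis.\<close>

locale finsupp_space =
  fixes M :: "('k::field_char_0, 'a \<Rightarrow>\<^sub>0 'k, 'm) superspace_scheme" and A :: "'a set"
  assumes carrier_M: "carrier M = {f. Poly_Mapping.keys f \<subseteq> A}"
    and zero_M [simp]: "\<zero>\<^bsub>M\<^esub> = 0"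
    and add_M [simp]: "x \<oplus>\<^bsub>M\<^esub> y = x + y"
    and smult_M [simp]: "c \<odot>\<^bsub>M\<^esub> x = Poly_Mapping.map ((*) c) x"
begin

lemma keys_scale: "Poly_Mapping.keys (Poly_Mapping.map ((*) c) p) \<subseteq> Poly_Mapping.keys (p :: 'a \<Rightarrow>\<^sub>0 'k)"
  by (auto simp: in_keys_iff)

lemma abelian_group: "abelian_group M"
proof (rule abelian_groupI)
  fix x y assume "x \<in> carrier M" "y \<in> carrier M"
  then show "x \<oplus>\<^bsub>M\<^esub> y \<in> carrier M" using keys_add[of x y] by (auto simp: carrier_M)
next
  fix x assume "x \<in> carrier M"
  then have "- x \<in> carrier M" by (simp add: carrier_M)
  then show "\<exists>y\<in>carrier M. y \<oplus>\<^bsub>M\<^esub> x = \<zero>\<^bsub>M\<^esub>" by (rule bexI[rotated]) simp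
qed (auto simp: carrier_M add_ac)

sublocale vspace M
  unfolding vspace_def
proof (rule moduleI[OF cring_from_type_algebra abelian_group])
  fix a :: 'k and x assume "x \<in> carrier M"
  then show "a \<odot>\<^bsub>M\<^esub> x \<in> carrier M" using keys_scale[of a x] by (auto simp: carrier_M)
qed (auto intro!: poly_mapping_eqI simp: lookup_add algebra_simps)

lemma zero_carrier_M [simp]: "0 \<in> carrier M"
  by (simp add: carrier_M)

lemma neg_M [simp]: "x \<in> carrier M \<Longrightarrow> \<ominus>\<^bsub>M\<^esub> x = - x"
  using sm_minus_one[of x] by (auto intro!: poly_mapping_eqI simp: poly_mapping_eq_iff fun_eq_iff)

lemma minus_M [simp]: "y \<in> carrier M \<Longrightarrow> x \<ominus>\<^bsub>M\<^esub> y = x - y"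
  by (simp add: a_minus_def)

lemma single_carrier [simp]: "u \<in> A \<Longrightarrow> Poly_Mapping.single u c \<in> carrier M"
  by (simp add: carrier_M)

lemma plus_carrier_M [simp]: "x \<in> carrier M \<Longrightarrow> y \<in> carrier M \<Longrightarrow> x + y \<in> carrier M"
  using M.a_closed[of x y] by simp

lemma scale_carrier_M [simp]: "x \<in> carrier M \<Longrightarrow> Poly_Mapping.map ((*) c) x \<in> carrier M"
  using sm_closed[of x c] by simp

lemma minus_carrier_M [simp]: "x \<in> carrier M \<Longrightarrow> y \<in> carrier M \<Longrightarrow> x - y \<in> carrier M"
  using M.minus_closed[of x y] by simp

lemma carrier_induct [consumes 1, case_names zero single add]:
  assumes "p \<in> carrier M" and "P 0"
    and "\<And>u c. u \<in> A \<Longrightarrow> P (Poly_Mapping.single u c)"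
    and "\<And>p q. p \<in> carrier M \<Longrightarrow> q \<in> carrier M \<Longrightarrow> P p \<Longrightarrow> P q \<Longrightarrow> P (p + q)"
  shows "P p"
  using assms unfolding carrier_M by (auto intro: poly_mapping_induct_keys[of p A P])

end

text \<open>The linear map with the values \<open>F\<close> on the basis; the sum inside
  \<open>env_act\<close> has this form.\<close>

definition lin_extension ::
  "('k::field_char_0, 'w, 'n) superspace_scheme \<Rightarrow> ('a \<Rightarrow> 'w) \<Rightarrow> ('a \<Rightarrow>\<^sub>0 'k) \<Rightarrow> 'w"
  where "lin_extension W F p = (\<Oplus>\<^bsub>W\<^esub>u\<in>Poly_Mapping.keys p. Poly_Mapping.lookup p u \<odot>\<^bsub>W\<^esub> F u)"

lemma lin_extension_single:
  fixes W :: "('k::field_char_0, 'w, 'n) superspace_scheme"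
  assumes "vspace W" "F u \<in> carrier W"
  shows "lin_extension W F (Poly_Mapping.single u c) = c \<odot>\<^bsub>W\<^esub> F u"
proof -
  interpret W: vspace W by fact
  show ?thesis
    using assms(2) by (cases "c = 0") (auto simp: lin_extension_def)
qed

lemma (in finsupp_space) lin_extension_linmap:
  fixes W :: "('k, 'w, 'n) superspace_scheme"
  assumes W: "vspace W" and F: "\<And>u. u \<in> A \<Longrightarrow> F u \<in> carrier W"
  shows "linmap M W (lin_extension W F)"
proof -
  interpret W: vspace W by fact
  \<comment> \<open>The keys of \<open>x\<close>, \<open>y\<close> and \<open>x + y\<close> differ,
    so the sums are first extended to a common finite index set, where the added terms have
    coefficient 0.\<close>
  have sup: "lin_extension W F p = (\<Oplus>\<^bsub>W\<^esub>u\<in>B. Poly_Mapping.lookup p u \<odot>\<^bsub>W\<^esub> F u)"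
    if "finite B" "Poly_Mapping.keys p \<subseteq> B" "B \<subseteq> A" for p B
    unfolding lin_extension_def
    by (rule W.M.add.finprod_mono_neutral_cong_left[OF that(1,2)])
      (use that F in \<open>auto simp: in_keys_iff\<close>)
  show ?thesis
  proof (unfold_locales, unfold linear_map_def, intro conjI ballI allI)
    show "lin_extension W F \<in> carrier M \<rightarrow> carrier W"
      using F by (auto simp: lin_extension_def carrier_M subset_iff intro!: W.M.finsum_closed)
  next
    fix x y assume "x \<in> carrier M" "y \<in> carrier M"
    then have k: "Poly_Mapping.keys x \<union> Poly_Mapping.keys y \<subseteq> A" by (auto simp: carrier_M)
    let ?B = "Poly_Mapping.keys x \<union> Poly_Mapping.keys y"
    have B: "finite ?B" "?B \<subseteq> A" "Poly_Mapping.keys x \<subseteq> ?B" "Poly_Mapping.keys y \<subseteq> ?B"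
      "Poly_Mapping.keys (x + y) \<subseteq> ?B"
      using k keys_add[of x y] by auto
    have FB: "\<forall>u\<in>?B. F u \<in> carrier W" using F B by auto
    have "(\<Oplus>\<^bsub>W\<^esub>u\<in>?B. Poly_Mapping.lookup (x + y) u \<odot>\<^bsub>W\<^esub> F u) =
        (\<Oplus>\<^bsub>W\<^esub>u\<in>?B. Poly_Mapping.lookup x u \<odot>\<^bsub>W\<^esub> F u \<oplus>\<^bsub>W\<^esub> Poly_Mapping.lookup y u \<odot>\<^bsub>W\<^esub> F u)"
      by (rule W.M.finsum_cong') (use FB in \<open>auto simp: lookup_add W.sm_add_left\<close>)
    also have "\<dots> = (\<Oplus>\<^bsub>W\<^esub>u\<in>?B. Poly_Mapping.lookup x u \<odot>\<^bsub>W\<^esub> F u)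
        \<oplus>\<^bsub>W\<^esub> (\<Oplus>\<^bsub>W\<^esub>u\<in>?B. Poly_Mapping.lookup y u \<odot>\<^bsub>W\<^esub> F u)"
      by (rule W.M.finsum_addf) (use FB in auto)
    finally show "lin_extension W F (x \<oplus>\<^bsub>M\<^esub> y) = lin_extension W F x \<oplus>\<^bsub>W\<^esub> lin_extension W F y"
      unfolding add_M sup[OF B(1,3,2)] sup[OF B(1,4,2)] sup[OF B(1,5,2)] .
  next
    fix c x assume "x \<in> carrier M"
    then have B: "Poly_Mapping.keys x \<subseteq> A" by (simp add: carrier_M)
    have "\<forall>u\<in>Poly_Mapping.keys x. F u \<in> carrier W" using F B by auto
    then show "lin_extension W F (c \<odot>\<^bsub>M\<^esub> x) = c \<odot>\<^bsub>W\<^esub> lin_extension W F x"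
      unfolding smult_M sup[OF finite_keys keys_scale B] sup[OF finite_keys subset_refl B]
      using W.finsum_smult_ldistr[OF finite_keys[of x], of c "\<lambda>u. Poly_Mapping.lookup x u \<odot>\<^bsub>W\<^esub> F u"]
      by (auto simp: W.sm_assoc intro!: W.M.finsum_cong')
  qed
qed

section \<open>The free algebra\<close>

text \<open>The product of \<open>free_algebra g\<close> is the same for all \<open>g\<close>; as a
  separate function on all finitely supported functions it obeys its laws without carrier
  conditions.\<close>

definition word_mult :: "('g list \<Rightarrow>\<^sub>0 'k::field_char_0) \<Rightarrow> ('g list \<Rightarrow>\<^sub>0 'k) \<Rightarrow> ('g list \<Rightarrow>\<^sub>0 'k)"
  where "word_mult f h = (\<Sum>u\<in>Poly_Mapping.keys f. \<Sum>v\<in>Poly_Mapping.keys h.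
       Poly_Mapping.single (u @ v) (Poly_Mapping.lookup f u * Poly_Mapping.lookup h v))"

lemma word_mult_superset:
  assumes "finite A" "Poly_Mapping.keys f \<subseteq> A" "finite B" "Poly_Mapping.keys h \<subseteq> B"
  shows "word_mult f h = (\<Sum>u\<in>A. \<Sum>v\<in>B.
       Poly_Mapping.single (u @ v) (Poly_Mapping.lookup f u * Poly_Mapping.lookup h v))"
proof -
  have "word_mult f h = (\<Sum>u\<in>Poly_Mapping.keys f. \<Sum>v\<in>B.
       Poly_Mapping.single (u @ v) (Poly_Mapping.lookup f u * Poly_Mapping.lookup h v))"
    unfolding word_mult_def
    by (intro sum.cong refl sum.mono_neutral_left) (use assms in \<open>auto simp: in_keys_iff\<close>)
  also have "\<dots> = (\<Sum>u\<in>A. \<Sum>v\<in>B.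
       Poly_Mapping.single (u @ v) (Poly_Mapping.lookup f u * Poly_Mapping.lookup h v))"
    by (intro sum.mono_neutral_left) (use assms in \<open>auto simp: in_keys_iff\<close>)
  finally show ?thesis .
qed

lemma word_mult_add_left: "word_mult (p + q) h = word_mult p h + word_mult q h"
proof -
  let ?A = "Poly_Mapping.keys p \<union> Poly_Mapping.keys q"
  have k: "finite ?A" "Poly_Mapping.keys p \<subseteq> ?A" "Poly_Mapping.keys q \<subseteq> ?A" "Poly_Mapping.keys (p + q) \<subseteq> ?A"
    using keys_add[of p q] by auto
  note s = word_mult_superset[OF k(1) _ finite_keys subset_refl]
  show ?thesis
    unfolding s[OF k(2)] s[OF k(3)] s[OF k(4)]
    by (simp add: lookup_add algebra_simps single_add sum.distrib)
qed

lemma word_mult_add_right: "word_mult h (p + q) = word_mult h p + word_mult h q"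
proof -
  let ?A = "Poly_Mapping.keys p \<union> Poly_Mapping.keys q"
  have k: "finite ?A" "Poly_Mapping.keys p \<subseteq> ?A" "Poly_Mapping.keys q \<subseteq> ?A" "Poly_Mapping.keys (p + q) \<subseteq> ?A"
    using keys_add[of p q] by auto
  note s = word_mult_superset[OF finite_keys subset_refl k(1)]
  show ?thesis
    unfolding s[OF k(2)] s[OF k(3)] s[OF k(4)]
    by (simp add: lookup_add algebra_simps single_add sum.distrib)
qed

lemma word_mult_zero [simp]: "word_mult 0 h = 0" "word_mult h 0 = 0"
  by (simp_all add: word_mult_def)

lemma word_mult_single [simp]:
  "word_mult (Poly_Mapping.single u a) (Poly_Mapping.single v b) = Poly_Mapping.single (u @ v) (a * b)"
  using word_mult_superset[of "{u}" "Poly_Mapping.single u a" "{v}" "Poly_Mapping.single v b"]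
  by simp

lemma word_mult_assoc: "word_mult (word_mult p q) r = word_mult p (word_mult q r)"
proof (induction p rule: poly_mapping_induct_single)
  case (single u a)
  show ?case
  proof (induction q rule: poly_mapping_induct_single)
    case (single v b)
    show ?case
      by (induction r rule: poly_mapping_induct_single)
        (simp_all add: word_mult_add_right mult.assoc)
  qed (simp_all add: word_mult_add_left word_mult_add_right)
qed (simp_all add: word_mult_add_left)

lemma scale_zero [simp]: "Poly_Mapping.map ((*) (c::'k::field)) 0 = 0"
  by (auto intro!: poly_mapping_eqI)

text \<open>Since scaling is multiplication by a multiple of the empty word, ideals of the free
  algebra are subspaces.\<close>

lemma word_mult_scale: "word_mult (Poly_Mapping.single [] c) p = Poly_Mapping.map ((*) c) p"
proof (induction p rule: poly_mapping_induct_single)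
  case (add p q)
  then show ?case by (auto simp: word_mult_add_right lookup_add distrib_left intro!: poly_mapping_eqI)
qed simp_all

lemma word_mult_one_right: "word_mult p (Poly_Mapping.single [] 1) = p"
  by (induction p rule: poly_mapping_induct_single) (simp_all add: word_mult_add_left)

lemma scale_one [simp]: "Poly_Mapping.map ((*) (1::'k::field)) p = p"
  by (auto intro!: poly_mapping_eqI)

lemma free_algebra_simps [simp]:
  "monoid.mult (free_algebra g) = word_mult" "\<one>\<^bsub>free_algebra g\<^esub> = Poly_Mapping.single [] 1"
  by (auto simp: free_algebra_def word_mult_def fun_eq_iff)

lemma free_algebra_finsupp: "finsupp_space (free_algebra g) (lists (carrier g))"
  by unfold_locales (auto simp: free_algebra_def)

interpretation free: finsupp_space "free_algebra g" "lists (carrier g)" for g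
  by (rule free_algebra_finsupp)

lemma word_mult_closed:
  assumes p: "p \<in> carrier (free_algebra g)" and q: "q \<in> carrier (free_algebra g)"
  shows "word_mult p q \<in> carrier (free_algebra g)"
  using p
proof (induction p rule: free.carrier_induct)
  case (single u a)
  show ?case using q
    by (induction q rule: free.carrier_induct) (use single in \<open>simp_all add: word_mult_add_right\<close>)
qed (simp_all add: word_mult_add_left)

lemma free_algebra_ring: "ring (free_algebra g)"
proof (rule ringI[OF free.abelian_group])
  show "monoid (free_algebra g)"
    by (rule monoidI) (auto simp: word_mult_closed word_mult_assoc word_mult_scale word_mult_one_right)
qed (auto simp: word_mult_add_left word_mult_add_right)

lemma letter_carrier: "x \<in> carrier g \<Longrightarrow> letter x \<in> carrier (free_algebra g)"
  by (simp add: letter_def)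

section \<open>The enveloping algebra\<close>

text \<open>These closure properties are shared by \<open>g\<close> and
  \<open>plus_subalgebra g\<close>, so both enveloping algebras are treated at once.\<close>

locale env_base =
  fixes g :: "('k::field_char_0, 'g, 'm) superspace_scheme" (structure)
  assumes add_closed: "x \<in> carrier g \<Longrightarrow> y \<in> carrier g \<Longrightarrow> x \<oplus> y \<in> carrier g"
    and sm_closed: "x \<in> carrier g \<Longrightarrow> c \<odot> x \<in> carrier g"
    and mult_closed: "x \<in> carrier g \<Longrightarrow> y \<in> carrier g \<Longrightarrow> x \<otimes> y \<in> carrier g"
    and grade_closed: "x \<in> grade g p \<Longrightarrow> x \<in> carrier g"
begin

lemma env_relations_closed: "env_relations g \<subseteq> carrier (free_algebra g)"
  by (auto simp: env_relations_def letter_carrier add_closed sm_closed mult_closed grade_closed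
      word_mult_closed)

lemma env_ideal: "ideal (env_ideal g) (free_algebra g)"
  unfolding env_ideal_def by (rule ring.genideal_ideal[OF free_algebra_ring env_relations_closed])

lemma env_ideal_minimal: "ideal J (free_algebra g) \<Longrightarrow> env_relations g \<subseteq> J \<Longrightarrow> env_ideal g \<subseteq> J"
  unfolding env_ideal_def by (rule ring.genideal_minimal[OF free_algebra_ring])

lemma env_relations_ideal: "env_relations g \<subseteq> env_ideal g"
  unfolding env_ideal_def by (rule ring.genideal_self[OF free_algebra_ring env_relations_closed])

lemma env_submodule: "submodule (env_ideal g) scalars (free_algebra g)"
proof -
  interpret I: ideal "env_ideal g" "free_algebra g" by (rule env_ideal)
  show ?thesis
  proof (rule free.subspaceI)
    fix c x assume x: "x \<in> env_ideal g"
    show "c \<odot>\<^bsub>free_algebra g\<^esub> x \<in> env_ideal g"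
      using I.I_l_closed[OF x, of "Poly_Mapping.single [] c"] by (simp add: word_mult_scale)
  qed (use I.a_subset I.zero_closed I.a_closed in auto)
qed

lemma env_algebra_simps:
  "carrier (env_algebra g) = a_rcosets\<^bsub>free_algebra g\<^esub> env_ideal g"
  "\<one>\<^bsub>env_algebra g\<^esub> = env_ideal g +>\<^bsub>free_algebra g\<^esub> Poly_Mapping.single [] 1"
  by (simp_all add: env_algebra_def quot_space_def)

abbreviation coset where "coset h \<equiv> env_ideal g +>\<^bsub>free_algebra g\<^esub> h"

lemma coset_carrier [simp]: "h \<in> carrier (free_algebra g) \<Longrightarrow> coset h \<in> carrier (env_algebra g)"
  by (auto simp: env_algebra_simps A_RCOSETS_def')

lemma env_mult:
  "p \<in> carrier (free_algebra g) \<Longrightarrow> q \<in> carrier (free_algebra g) \<Longrightarrow>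
    coset p \<otimes>\<^bsub>env_algebra g\<^esub> coset q = coset (word_mult p q)"
  using ideal.rcoset_mult_add[OF env_ideal, of p q] by (simp add: env_algebra_def quot_space_def)

lemma env_add:
  "p \<in> carrier (free_algebra g) \<Longrightarrow> q \<in> carrier (free_algebra g) \<Longrightarrow>
    coset p \<oplus>\<^bsub>env_algebra g\<^esub> coset q = coset (p + q)"
  using free.coset_add[OF env_submodule, of p q] by (simp add: env_algebra_def quot_space_def)

lemma env_smult:
  "p \<in> carrier (free_algebra g) \<Longrightarrow>
    c \<odot>\<^bsub>env_algebra g\<^esub> coset p = coset (Poly_Mapping.map ((*) c) p)"
  using free.coset_smult[OF env_submodule, of p c] by (simp add: env_algebra_def quot_space_def)

lemma env_algebraE:
  assumes "D \<in> carrier (env_algebra g)"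
  obtains h where "h \<in> carrier (free_algebra g)" "D = coset h"
  using assms unfolding env_algebra_simps by (rule a_rcosetsE)

end

locale word_action = env_base g + N: vspace N
  for g :: "('k::field_char_0, 'g, 'm) superspace_scheme"
    and N :: "('k, 'n, 'l) superspace_scheme" +
  fixes \<rho> assumes action: "lie_action g N \<rho>"
begin

text \<open>The extension of \<open>\<rho>\<close> to the free algebra: a word acts by the composite
  of its letters, the last letter first.\<close>

definition word_act :: "('g list \<Rightarrow>\<^sub>0 'k) \<Rightarrow> 'n \<Rightarrow> 'n"
  where "word_act h n = lin_extension N (\<lambda>u. foldr \<rho> u n) h"

lemma action_linmap: "x \<in> carrier g \<Longrightarrow> linmap N N (\<rho> x)"
  using action by unfold_locales (auto simp: lie_action_def even_bilinear_def)

lemma action_closed [simp]: "x \<in> carrier g \<Longrightarrow> n \<in> carrier N \<Longrightarrow> \<rho> x n \<in> carrier N"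
  using linmap.closed[OF action_linmap] .

lemma action_left:
  assumes "n \<in> carrier N"
  shows "x \<in> carrier g \<Longrightarrow> y \<in> carrier g \<Longrightarrow> \<rho> (x \<oplus>\<^bsub>g\<^esub> y) n = \<rho> x n \<oplus>\<^bsub>N\<^esub> \<rho> y n"
    "x \<in> carrier g \<Longrightarrow> \<rho> (c \<odot>\<^bsub>g\<^esub> x) n = c \<odot>\<^bsub>N\<^esub> \<rho> x n"
  using action assms by (auto simp: lie_action_def even_bilinear_def linear_map_def)

lemma foldr_linmap: "u \<in> lists (carrier g) \<Longrightarrow> linmap N N (foldr \<rho> u)"
proof (induction u)
  case Nil
  show ?case by unfold_locales (simp add: linear_map_def)
next
  case (Cons x u)
  then show ?case using linmap_comp[OF _ action_linmap[of x], of N "foldr \<rho> u"] by (simp add: comp_def)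
qed

lemma foldr_closed [simp]: "u \<in> lists (carrier g) \<Longrightarrow> n \<in> carrier N \<Longrightarrow> foldr \<rho> u n \<in> carrier N"
  using linmap.closed[OF foldr_linmap] .

lemma word_act_linmap: "n \<in> carrier N \<Longrightarrow> linmap (free_algebra g) N (\<lambda>h. word_act h n)"
  unfolding word_act_def using free.lin_extension_linmap[OF N.vspace_axioms, of g] by simp

lemma word_act_closed [simp]: "h \<in> carrier (free_algebra g) \<Longrightarrow> n \<in> carrier N \<Longrightarrow> word_act h n \<in> carrier N"
  using linmap.closed[OF word_act_linmap] .

lemma word_act_zero [simp]: "n \<in> carrier N \<Longrightarrow> word_act 0 n = \<zero>\<^bsub>N\<^esub>"
  using linmap.zero[OF word_act_linmap] by simp

lemma word_act_add: "p \<in> carrier (free_algebra g) \<Longrightarrow> q \<in> carrier (free_algebra g) \<Longrightarrow> n \<in> carrier N \<Longrightarrow>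
   word_act (p + q) n = word_act p n \<oplus>\<^bsub>N\<^esub> word_act q n"
  using linmap.add[OF word_act_linmap] by simp

lemma word_act_minus: "p \<in> carrier (free_algebra g) \<Longrightarrow> q \<in> carrier (free_algebra g) \<Longrightarrow> n \<in> carrier N \<Longrightarrow>
   word_act (p - q) n = word_act p n \<ominus>\<^bsub>N\<^esub> word_act q n"
  using linmap.minus[OF word_act_linmap] by simp

lemma word_act_scale: "p \<in> carrier (free_algebra g) \<Longrightarrow> n \<in> carrier N \<Longrightarrow>
   word_act (Poly_Mapping.map ((*) c) p) n = c \<odot>\<^bsub>N\<^esub> word_act p n"
  using linmap.sm[OF word_act_linmap] by simp

lemma word_act_single: "u \<in> lists (carrier g) \<Longrightarrow> n \<in> carrier N \<Longrightarrow>
   word_act (Poly_Mapping.single u c) n = c \<odot>\<^bsub>N\<^esub> foldr \<rho> u n"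
  unfolding word_act_def by (rule lin_extension_single[OF N.vspace_axioms]) simp

lemma word_act_linmap_right:
  assumes "h \<in> carrier (free_algebra g)" shows "linmap N N (word_act h)"
  using assms
proof (induction h rule: free.carrier_induct)
  case zero
  show ?case by unfold_locales (auto simp: linear_map_def)
next
  case (single u c)
  interpret linmap N N "foldr \<rho> u" using single by (simp add: foldr_linmap)
  show ?case using single
    by unfold_locales (auto simp: linear_map_def word_act_single add sm N.sm_add_right N.sm_assoc mult.commute)
next
  case (add p q)
  interpret p: linmap N N "word_act p" by fact
  interpret q: linmap N N "word_act q" by fact
  show ?case using add(1,2)
    by unfold_locales
      (auto simp: linear_map_def word_act_add p.add p.sm q.add q.sm N.sm_add_right N.M.add.m_ac)
qed

lemma word_act_mult:
  assumes p: "p \<in> carrier (free_algebra g)" and q: "q \<in> carrier (free_algebra g)" and n: "n \<in> carrier N"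
  shows "word_act (word_mult p q) n = word_act p (word_act q n)"
  using p
proof (induction p rule: free.carrier_induct)
  case (single u a)
  interpret u: linmap N N "foldr \<rho> u" using single by (simp add: foldr_linmap)
  show ?case using q
  proof (induction q rule: free.carrier_induct)
    case zero
    then show ?case using single n by (simp add: word_act_single)
  next
    case (single v b)
    then show ?case using \<open>u \<in> _\<close> n by (simp add: word_act_single u.sm N.sm_assoc)
  next
    case (add p q)
    then show ?case using single n
      by (simp add: word_mult_add_right word_act_add word_mult_closed word_act_single u.add N.sm_add_right)
  qed
qed (use q n in \<open>simp_all add: word_mult_add_left word_act_add word_mult_closed\<close>)

lemma word_act_letter: "x \<in> carrier g \<Longrightarrow> n \<in> carrier N \<Longrightarrow> word_act (letter x) n = \<rho> x n"
  by (simp add: letter_def word_act_single)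

text \<open>The three families of relations mirror additivity, homogeneity and the bracket rule of
  \<open>\<rho>\<close>.\<close>

lemma word_act_relation:
  assumes r: "r \<in> env_relations g" and n: "n \<in> carrier N"
  shows "word_act r n = \<zero>\<^bsub>N\<^esub>"
proof -
  note simps = letter_carrier add_closed sm_closed mult_closed grade_closed word_mult_closed
    word_act_minus word_act_add word_act_scale word_act_mult word_act_letter action_left n N.M.r_neg
  consider (add) x y where "x \<in> carrier g" "y \<in> carrier g" "r = letter (x \<oplus>\<^bsub>g\<^esub> y) - (letter x + letter y)"
    | (sm) c x where "x \<in> carrier g" "r = letter (c \<odot>\<^bsub>g\<^esub> x) - Poly_Mapping.map ((*) c) (letter x)"
    | (br) x y p q where "x \<in> grade g p" "y \<in> grade g q" "r = word_mult (letter x) (letter y)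
       - Poly_Mapping.map ((*) (zeta p q)) (word_mult (letter y) (letter x)) - letter (x \<otimes>\<^bsub>g\<^esub> y)"
    using r unfolding env_relations_def by auto
  then show ?thesis
  proof cases
    case br
    have "\<rho> (x \<otimes>\<^bsub>g\<^esub> y) n = \<rho> x (\<rho> y n) \<ominus>\<^bsub>N\<^esub> zeta p q \<odot>\<^bsub>N\<^esub> \<rho> y (\<rho> x n)"
      using action br n by (simp add: lie_action_def)
    then show ?thesis using br by (simp add: simps a_minus_def)
  qed (simp_all add: simps a_minus_def)
qed

text \<open>The annihilator \<open>J\<close> of all of \<open>N\<close> is a two-sided ideal
  containing the relations. Closure under multiplication from the right uses that \<open>x\<close>
  maps \<open>N\<close> into \<open>N\<close>.\<close>

lemma env_ideal_act:
  assumes h: "h \<in> env_ideal g" and n: "n \<in> carrier N"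
  shows "word_act h n = \<zero>\<^bsub>N\<^esub>"
proof -
  define J where "J = {h \<in> carrier (free_algebra g). \<forall>n\<in>carrier N. word_act h n = \<zero>\<^bsub>N\<^esub>}"
  have "submodule J scalars (free_algebra g)"
    by (rule free.subspaceI) (auto simp: J_def word_act_add word_act_scale)
  then have "subgroup J (add_monoid (free_algebra g))" by (rule submodule.axioms)
  then have "ideal J (free_algebra g)"
  proof (rule idealI[OF free_algebra_ring])
    fix a x assume "a \<in> J" "x \<in> carrier (free_algebra g)"
    then show "x \<otimes>\<^bsub>free_algebra g\<^esub> a \<in> J" "a \<otimes>\<^bsub>free_algebra g\<^esub> x \<in> J"
      using linmap.zero[OF word_act_linmap_right[of x]]
      by (auto simp: J_def word_act_mult word_mult_closed)
  qed
  moreover have "env_relations g \<subseteq> J"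
    using env_relations_closed by (auto simp: J_def word_act_relation)
  ultimately show ?thesis using env_ideal_minimal h n unfolding J_def by blast
qed

lemma coset_act_eq:
  assumes h: "h \<in> carrier (free_algebra g)" and f: "f \<in> coset h" and n: "n \<in> carrier N"
  shows "word_act f n = word_act h n"
proof -
  have "f \<in> carrier (free_algebra g)" "f - h \<in> env_ideal g"
    using free.coset_mem_iff[OF env_submodule h] f h by auto
  then show ?thesis using env_ideal_act[of "f - h"] h n
    by (simp add: word_act_minus N.minus_eq_zero_iff)
qed

text \<open>All representatives act alike, so the image read by \<open>the_elem\<close> is a
  singleton.\<close>

lemma env_act_coset:
  assumes h: "h \<in> carrier (free_algebra g)" and n: "n \<in> carrier N"
  shows "env_act N \<rho> (coset h) n = word_act h n"
proof -
  have "(\<lambda>f. word_act f n) ` coset h = (\<lambda>f. word_act h n) ` coset h"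
    by (rule image_cong[OF refl]) (rule coset_act_eq[OF h _ n])
  also have "\<dots> = {word_act h n}"
    by (rule image_constant[OF free.coset_self[OF env_submodule h]])
  finally have "(\<lambda>f. word_act f n) ` coset h = {word_act h n}" .
  then show ?thesis by (simp add: env_act_def word_act_def lin_extension_def)
qed

end

section \<open>The subalgebra of nonnegative modes\<close>

context local_lie_algebra
begin

text \<open>Multiplication by \<open>z - w\<close> reads coefficients at equal or larger indices, so
  nonnegative indices never lead to negative ones.\<close>

lemma mult_z_minus_w_mem:
  assumes H: "submodule H scalars g" and c: "\<And>s t. s \<ge> 0 \<Longrightarrow> t \<ge> 0 \<Longrightarrow> c s t \<in> H" and "s \<ge> 0" "t \<ge> 0"
  shows "(mult_z_minus_w g ^^ n) c s t \<in> H"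
  using assms(3,4)
proof (induction n arbitrary: s t)
  case (Suc n)
  then show ?case
    using subspaceD(3,5)[OF H] by (simp add: mult_z_minus_w_def a_minus_def)
qed (simp add: c)

lemma mult_z_minus_w_closed:
  assumes "\<And>s t. c s t \<in> carrier g"
  shows "(mult_z_minus_w g ^^ n) c s t \<in> carrier g"
  using assms by (induction n arbitrary: s t) (auto simp: mult_z_minus_w_def)

lemma dist_closure_carrier: "a \<in> dist_closure g (gen_fields g) \<Longrightarrow> a t \<in> carrier g"
proof (induction arbitrary: t rule: dist_closure.induct)
  case (prod a b n)
  then show ?case
    unfolding dist_prod_def res_z_def
    by (intro mult_z_minus_w_closed) (simp add: dist_bracket_def)
qed (auto simp: gen_fields_carrier ddz_def)

text \<open>
  Since \<open>(z - w)\<^sup>n [a(z), b(w)]\<close> has coefficients satisfying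
  \<open>E\<^sub>n(s + 1, t) = E\<^bsub>n+1\<^esub>(s, t) + E\<^sub>n(s, t + 1)\<close>, the brackets of nonnegative modes are combinations of the
  \<open>E\<^sub>n(0, t)\<close>, which are the modes of the products of \<open>a(z)\<close> and \<open>b(z)\<close>.
\<close>

lemma bracket_modes_mem:
  assumes H: "submodule H scalars g" and c: "\<And>t. a t \<in> carrier g" "\<And>t. b t \<in> carrier g"
    and prod: "\<And>n t. t \<ge> 0 \<Longrightarrow> dist_prod g n a b t \<in> H" and st: "s \<ge> 0" "t \<ge> 0"
  shows "a s \<otimes> b t \<in> H"
proof -
  define E where "E n = (mult_z_minus_w g ^^ n) (dist_bracket g a b)" for n
  have E_closed: "E n s t \<in> carrier g" for n s t
    unfolding E_def by (rule mult_z_minus_w_closed) (simp add: dist_bracket_def c)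
  have "E n (int k) t \<in> H" if "t \<ge> 0" for n k t
    using that
  proof (induction k arbitrary: n t)
    case 0
    then show ?case using prod[of t n] by (simp add: E_def dist_prod_def res_z_def)
  next
    case (Suc k)
    have "E (Suc n) (int k) t = E n (int k + 1) t \<ominus> E n (int k) (t + 1)"
      by (simp add: E_def mult_z_minus_w_def)
    then have "E n (int (Suc k)) t = E (Suc n) (int k) t \<oplus> E n (int k) (t + 1)"
      using E_closed by (simp add: a_minus_def M.add.m_assoc M.l_neg add.commute)
    then show ?case using Suc subspaceD(3)[OF H] by simp
  qed
  from this[of t 0 "nat s"] show ?thesis using st by (simp add: E_def dist_bracket_def)
qed

abbreviation plus_modes where
  "plus_modes \<equiv> {a t |a t. a \<in> dist_closure g (gen_fields g) \<and> t \<ge> 0}"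

lemma plus_submodule: "submodule (plus_carrier g) scalars g"
  unfolding plus_carrier_def
  by (rule lin_span_submodule[OF vspace]) (auto simp: dist_closure_carrier)

lemma plus_modes_mem: "a \<in> dist_closure g (gen_fields g) \<Longrightarrow> t \<ge> 0 \<Longrightarrow> a t \<in> plus_carrier g"
  using lin_span_superset[of plus_modes g] unfolding plus_carrier_def by auto

lemma plus_carrier_closed: "x \<in> plus_carrier g \<Longrightarrow> x \<in> carrier g"
  using subspaceD(1)[OF plus_submodule] by auto

lemma plus_carrier_subset: "submodule H scalars g \<Longrightarrow> plus_modes \<subseteq> H \<Longrightarrow> plus_carrier g \<subseteq> H"
  unfolding plus_carrier_def by (rule lin_span_induct)

text \<open>For modes this is \<open>bracket_modes_mem\<close>, as \<open>dist_closure\<close>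
  contains the products of its members. Linearity extends it to the span, first in \<open>y\<close>
  and then in \<open>x\<close>.\<close>

lemma plus_bracket_closed:
  assumes x: "x \<in> plus_carrier g" and y: "y \<in> plus_carrier g"
  shows "x \<otimes> y \<in> plus_carrier g"
proof -
  note P = subspaceD[OF plus_submodule]
  note lin = linmap.add[OF mult_right] linmap.sm[OF mult_right] linmap.zero[OF mult_right]
    linmap.add[OF mult_left] linmap.sm[OF mult_left] linmap.zero[OF mult_left]
  have modes: "a s \<otimes> b t \<in> plus_carrier g"
    if a: "a \<in> dist_closure g (gen_fields g)" and b: "b \<in> dist_closure g (gen_fields g)"
      and st: "s \<ge> 0" "t \<ge> 0" for a b s t
  proof (rule bracket_modes_mem[OF plus_submodule])
    show "dist_prod g n a b t \<in> plus_carrier g" if "t \<ge> 0" for n t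
      using dist_closure.prod[OF a b, of n] that plus_modes_mem by blast
  qed (use that dist_closure_carrier in auto)
  have left: "a s \<otimes> y \<in> plus_carrier g" if a: "a \<in> dist_closure g (gen_fields g)" and s: "s \<ge> 0" for a s
  proof -
    have "submodule {y \<in> carrier g. a s \<otimes> y \<in> plus_carrier g} scalars g"
      by (rule subspaceI) (use P dist_closure_carrier[OF a] in \<open>auto simp: lin\<close>)
    moreover have "plus_modes \<subseteq> {y \<in> carrier g. a s \<otimes> y \<in> plus_carrier g}"
      using modes a s dist_closure_carrier by auto
    ultimately show ?thesis using y plus_carrier_subset by blast
  qed
  have yc: "y \<in> carrier g" using y plus_carrier_closed by blast
  have "submodule {x \<in> carrier g. x \<otimes> y \<in> plus_carrier g} scalars g"
    by (rule subspaceI) (use P yc in \<open>auto simp: lin\<close>)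
  moreover have "plus_modes \<subseteq> {x \<in> carrier g. x \<otimes> y \<in> plus_carrier g}"
    using left dist_closure_carrier by auto
  ultimately show ?thesis using x plus_carrier_subset by blast
qed

text \<open>The annihilator of an even vector is a graded subspace, so that closure under brackets, known for
  homogeneous elements, extends to all of it.\<close>

lemma plus_annihilates:
  assumes act: "lie_action g N \<rho>" and N: "superspace N" and w: "w \<in> grade N 0"
    and gen: "\<And>a t. a \<in> gen_fields g \<Longrightarrow> t \<ge> 0 \<Longrightarrow> \<rho> (a t) w = \<zero>\<^bsub>N\<^esub>"
    and x: "x \<in> plus_carrier g"
  shows "\<rho> x w = \<zero>\<^bsub>N\<^esub>"
proof -
  interpret N: superspace N by fact
  note lin = lie_action_linmaps[OF act N]
  have wc: "w \<in> carrier N" using w by simp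
  interpret w: linmap g N "\<lambda>x. \<rho> x w" by (rule lin(2)[OF wc])
  define K where "K = {x \<in> carrier g. \<rho> x w = \<zero>\<^bsub>N\<^esub>}"
  have K: "submodule K scalars g"
    by (rule subspaceI) (auto simp: K_def w.add w.sm)
  note KD = subspaceD[OF K]
  have hom: "x \<otimes> y \<in> K" if "x \<in> grade g p" "y \<in> grade g q" "x \<in> K" "y \<in> K" for x y p q
  proof -
    have "\<rho> (x \<otimes> y) w = \<rho> x (\<rho> y w) \<ominus>\<^bsub>N\<^esub> zeta p q \<odot>\<^bsub>N\<^esub> \<rho> y (\<rho> x w)"
      using act that wc unfolding lie_action_def by blast
    also have "\<dots> = \<zero>\<^bsub>N\<^esub>"
      using that linmap.zero[OF lin(1)] by (simp add: K_def a_minus_def)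
    finally show ?thesis using that by (simp add: K_def)
  qed
  have comp: "\<exists>x0 x1. x0 \<in> grade g 0 \<and> x1 \<in> grade g 1 \<and> x0 \<in> K \<and> x1 \<in> K \<and> x = x0 \<oplus> x1"
    if x: "x \<in> K" for x
  proof -
    have "x \<in> carrier g" using x by (simp add: K_def)
    then obtain x0 x1 where d: "x0 \<in> grade g 0" "x1 \<in> grade g 1" "x = x0 \<oplus> x1"
      by (rule grade_decomp)
    have "\<rho> x0 w \<in> grade N (0 + 0)" "\<rho> x1 w \<in> grade N (1 + 0)"
      using lin(3)[OF d(1) w] lin(3)[OF d(2) w] .
    then have "\<rho> x0 w = \<zero>\<^bsub>N\<^esub> \<and> \<rho> x1 w = \<zero>\<^bsub>N\<^esub>"
      using x d by (intro N.grade_sum_zero[of _ "0 + 0" _ "1 + 0"]) (auto simp: K_def w.add)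
    then have "x0 \<in> K" "x1 \<in> K" using d by (auto simp: K_def)
    then show ?thesis using d by blast
  qed
  have br: "x \<otimes> y \<in> K" if xy: "x \<in> K" "y \<in> K" for x y
  proof -
    obtain x0 x1 y0 y1 where *: "x0 \<in> grade g 0" "x1 \<in> grade g 1" "x0 \<in> K" "x1 \<in> K" "x = x0 \<oplus> x1"
      "y0 \<in> grade g 0" "y1 \<in> grade g 1" "y0 \<in> K" "y1 \<in> K" "y = y0 \<oplus> y1"
      using comp[OF xy(1)] comp[OF xy(2)] by blast
    then have "x \<otimes> y = (x0 \<otimes> y0 \<oplus> x1 \<otimes> y0) \<oplus> (x0 \<otimes> y1 \<oplus> x1 \<otimes> y1)"
      by (simp add: linmap.add[OF mult_right] linmap.add[OF mult_left])
    then show ?thesis using hom * KD(3) by metis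
  qed
  have "a t \<in> K" if "a \<in> dist_closure g (gen_fields g)" "t \<ge> 0" for a t
    using that
  proof (induction arbitrary: t rule: dist_closure.induct)
    case (base a)
    then show ?case using gen gen_fields_carrier by (simp add: K_def)
  next
    case (ddz a)
    have "a t' \<in> carrier g" for t' using ddz.hyps dist_closure_carrier by blast
    \<comment> \<open>At \<open>t = 0\<close> the derivative refers to the mode \<open>-1\<close>,
      to which the induction hypothesis does not reach, but with coefficient 0.\<close>
    then show ?case using ddz.IH[of "t - 1"] ddz.prems KD(2,4) by (cases "t = 0") (auto simp: ddz_def)
  next
    case (prod a b n)
    show ?case unfolding dist_prod_def res_z_def
      by (rule mult_z_minus_w_mem[OF K]) (use prod br in \<open>auto simp: dist_bracket_def\<close>)
  qed (use KD in auto)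
  then have "plus_carrier g \<subseteq> K"
    by (intro plus_carrier_subset[OF K]) auto
  then show ?thesis using x by (auto simp: K_def)
qed

lemma plus_subalgebra_simps [simp]:
  "carrier (plus_subalgebra g) = plus_carrier g"
  "x \<oplus>\<^bsub>plus_subalgebra g\<^esub> y = x \<oplus> y" "x \<otimes>\<^bsub>plus_subalgebra g\<^esub> y = x \<otimes> y"
  "c \<odot>\<^bsub>plus_subalgebra g\<^esub> x = c \<odot> x" "grade (plus_subalgebra g) p = grade g p \<inter> plus_carrier g"
  by (simp_all add: plus_subalgebra_def)

sublocale env_base g
  by unfold_locales auto

sublocale plus: env_base "plus_subalgebra g"
  by unfold_locales (use subspaceD[OF plus_submodule] in \<open>auto simp: plus_bracket_closed\<close>)

lemma plus_free_closed: "h \<in> carrier (free_algebra (plus_subalgebra g)) \<Longrightarrow> h \<in> carrier (free_algebra g)"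
  using plus_carrier_closed by (auto simp: free.carrier_M)

text \<open>The intersection \<open>J\<close> is an ideal of the smaller free algebra and contains
  its relations, hence the ideal they generate. This makes the canonical map between the enveloping
  algebras well defined.\<close>

lemma plus_ideal_subset: "env_ideal (plus_subalgebra g) \<subseteq> env_ideal g"
proof -
  let ?R = "free_algebra (plus_subalgebra g)"
  define J where "J = env_ideal g \<inter> carrier ?R"
  note I = free.subspaceD[OF env_submodule]
  have "submodule J scalars ?R"
    by (rule free.subspaceI) (use I in \<open>auto simp: J_def\<close>)
  then have "subgroup J (add_monoid ?R)" by (rule submodule.axioms)
  then have "ideal J ?R"
  proof (rule idealI[OF free_algebra_ring])
    fix a x assume "a \<in> J" "x \<in> carrier ?R"
    then show "x \<otimes>\<^bsub>?R\<^esub> a \<in> J" "a \<otimes>\<^bsub>?R\<^esub> x \<in> J"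
      using ideal.I_l_closed[OF env_ideal, of a x] ideal.I_r_closed[OF env_ideal, of a x] plus_free_closed[of x]
      by (auto simp: J_def word_mult_closed)
  qed
  moreover have "env_relations (plus_subalgebra g) \<subseteq> env_relations g"
    unfolding env_relations_def plus_subalgebra_simps free_algebra_simps
    by (intro Un_mono) (use plus_carrier_closed in blast)+
  then have "env_relations (plus_subalgebra g) \<subseteq> J"
    using plus.env_relations_closed env_relations_ideal unfolding J_def by blast
  ultimately show ?thesis using plus.env_ideal_minimal[of J] unfolding J_def by blast
qed

lemma env_incl_coset:
  assumes h: "h \<in> carrier (free_algebra (plus_subalgebra g))"
  shows "env_incl g (plus.coset h) = coset h"
  unfolding env_incl_def
proof (rule free.coset_Union[OF plus.env_submodule h])
  fix y assume "y \<in> plus.coset h"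
  then have "y \<in> carrier (free_algebra (plus_subalgebra g))" "y - h \<in> env_ideal (plus_subalgebra g)"
    using free.coset_mem_iff[OF plus.env_submodule h] h by auto
  then show "coset y = coset h"
    using free.coset_eq_iff[OF env_submodule, of y h] plus_free_closed plus_ideal_subset h by auto
qed

end

section \<open>The trivial module\<close>

lemma scalar_space_simps [simp]:
  "carrier scalar_space = UNIV" "\<zero>\<^bsub>scalar_space\<^esub> = 0" "x \<oplus>\<^bsub>scalar_space\<^esub> y = x + y"
  "c \<odot>\<^bsub>scalar_space\<^esub> x = c * x"
  by (simp_all add: scalar_space_def)

lemma scalar_space_vspace: "vspace scalar_space"
  unfolding vspace_def
proof (rule moduleI[OF cring_from_type_algebra abelian_groupI])
  show "\<exists>y\<in>carrier scalar_space. y \<oplus>\<^bsub>scalar_space\<^esub> x = \<zero>\<^bsub>scalar_space\<^esub>" for x :: 'a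
    by (rule bexI[of _ "- x"]) auto
qed (auto simp: algebra_simps)

context local_lie_algebra
begin

interpretation scalar: vspace scalar_space
  by (rule scalar_space_vspace)

interpretation triv: word_action "plus_subalgebra g" scalar_space trivial_act
proof unfold_locales
  have "\<zero>\<^bsub>scalar_space\<^esub> = \<zero>\<^bsub>scalar_space\<^esub> \<ominus>\<^bsub>scalar_space\<^esub> (c :: 'k) \<odot>\<^bsub>scalar_space\<^esub> \<zero>\<^bsub>scalar_space\<^esub>" for c
    unfolding scalar.sm_zero_right 
    using scalar.minus_eq_zero_iff[OF scalar.M.zero_closed scalar.M.zero_closed, THEN iffD2, OF refl]
    by (rule sym)
  then show "lie_action (plus_subalgebra g) scalar_space trivial_act"
    by (auto simp: lie_action_def even_bilinear_def linear_map_def trivial_act_def scalar_space_def)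
qed

text \<open>Letters act by zero, so only the empty word contributes: the action is through the
  augmentation of the enveloping algebra.\<close>

lemma env_act_trivial:
  assumes h: "h \<in> carrier (free_algebra (plus_subalgebra g))"
  shows "env_act scalar_space trivial_act (plus.coset h) c = Poly_Mapping.lookup h [] * c"
proof -
  have "triv.word_act h c = Poly_Mapping.lookup h [] * c"
    using h
  proof (induction h rule: free.carrier_induct)
    case (single u k)
    then have "triv.word_act (Poly_Mapping.single u k) c = k * foldr trivial_act u c"
      using triv.word_act_single[of u c k] by simp
    moreover have "foldr trivial_act u c = (if u = [] then c else 0)"
      by (cases u) (simp_all add: trivial_act_def)
    ultimately show ?case by (simp add: lookup_single)
  next
    case (add p q)
    then show ?case using triv.word_act_add[of p q c] by (simp add: lookup_add algebra_simps)
  qed (use triv.word_act_zero in simp)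
  then show ?thesis using triv.env_act_coset[OF h] by simp
qed

end

section \<open>The universal module\<close>

lemma pair_space_finsupp: "finsupp_space (pair_space M N) (carrier M \<times> carrier N)"
  by unfold_locales (auto simp: pair_space_def)

lemma scale_single: "Poly_Mapping.map ((*) c) (Poly_Mapping.single u d) = Poly_Mapping.single u (c * d :: 'k::field)"
  by (rule poly_mapping_eqI) (simp add: lookup_single when_def)

context local_lie_algebra
begin

abbreviation pairs where "pairs \<equiv> pair_space (env_algebra g) scalar_space"

interpretation pairs: finsupp_space pairs "carrier (env_algebra g) \<times> UNIV"
  using pair_space_finsupp[of "env_algebra g" scalar_space] by simp

abbreviation pcoset where "pcoset F \<equiv> univ_relations g +>\<^bsub>pairs\<^esub> F"

text \<open>The relations of the tensor product before the span is taken, named so that single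
  relations can be used and linear maps checked on them.\<close>

definition univ_generators where
  "univ_generators =
    {pair (m \<oplus>\<^bsub>env_algebra g\<^esub> m') n - (pair m n + pair m' n) |m m' n.
        m \<in> carrier (env_algebra g) \<and> m' \<in> carrier (env_algebra g) \<and> n \<in> carrier scalar_space} \<union>
     {pair m (n \<oplus>\<^bsub>scalar_space\<^esub> n') - (pair m n + pair m n') |m n n'.
        m \<in> carrier (env_algebra g) \<and> n \<in> carrier scalar_space \<and> n' \<in> carrier scalar_space} \<union>
     {pair (c \<odot>\<^bsub>env_algebra g\<^esub> m) n - Poly_Mapping.map ((*) c) (pair m n) |c m n.
        m \<in> carrier (env_algebra g) \<and> n \<in> carrier scalar_space} \<union>
     {pair m (c \<odot>\<^bsub>scalar_space\<^esub> n) - Poly_Mapping.map ((*) c) (pair m n) |c m n.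
        m \<in> carrier (env_algebra g) \<and> n \<in> carrier scalar_space} \<union>
     {pair (m \<otimes>\<^bsub>env_algebra g\<^esub> env_incl g a) n - pair m (env_act scalar_space trivial_act a n) |m a n.
        m \<in> carrier (env_algebra g) \<and> a \<in> carrier (env_algebra (plus_subalgebra g)) \<and> n \<in> carrier scalar_space}"

lemma univ_generatorsI:
  assumes "m \<in> carrier (env_algebra g)"
  shows "m' \<in> carrier (env_algebra g) \<Longrightarrow>
      pair (m \<oplus>\<^bsub>env_algebra g\<^esub> m') n - (pair m n + pair m' n) \<in> univ_generators"
    and "pair (c \<odot>\<^bsub>env_algebra g\<^esub> m) n - Poly_Mapping.map ((*) c) (pair m n) \<in> univ_generators"
    and "pair m (c * n) - Poly_Mapping.map ((*) c) (pair m n) \<in> univ_generators"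
  using assms unfolding univ_generators_def scalar_space_simps by blast+

lemma univ_relations_span: "univ_relations g = lin_span pairs univ_generators"
  unfolding univ_relations_def tensor_relations_def univ_generators_def ..

text \<open>Elements of the enveloping algebras are replaced by representatives in the free
  algebras. The balancing relation becomes
  \<open>h h' \<otimes> c = h \<otimes> \<epsilon>(h') c\<close>, with \<open>\<epsilon>(h')\<close>
  the coefficient of the empty word in \<open>h'\<close>.\<close>

lemma univ_generators_cases [consumes 1, case_names add_left add_right smult_left smult_right balanced]:
  assumes "r \<in> univ_generators"
  obtains h h' c where "h \<in> carrier (free_algebra g)" "h' \<in> carrier (free_algebra g)"
      "r = pair (coset (h + h')) c - (pair (coset h) c + pair (coset h') c)"
    | h c c' where "h \<in> carrier (free_algebra g)" "r = pair (coset h) (c + c') - (pair (coset h) c + pair (coset h) c')"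
    | k h c where "h \<in> carrier (free_algebra g)"
      "r = pair (coset (Poly_Mapping.map ((*) k) h)) c - Poly_Mapping.map ((*) k) (pair (coset h) c)"
    | k h c where "h \<in> carrier (free_algebra g)"
      "r = pair (coset h) (k * c) - Poly_Mapping.map ((*) k) (pair (coset h) c)"
    | h h' c where "h \<in> carrier (free_algebra g)" "h' \<in> carrier (free_algebra (plus_subalgebra g))"
      "r = pair (coset (word_mult h h')) c - pair (coset h) (Poly_Mapping.lookup h' [] * c)"
  using assms unfolding univ_generators_def
proof (elim UnE)
  assume "r \<in> {pair (m \<oplus>\<^bsub>env_algebra g\<^esub> m') n - (pair m n + pair m' n) |m m' n.
        m \<in> carrier (env_algebra g) \<and> m' \<in> carrier (env_algebra g) \<and> n \<in> carrier scalar_space}"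
  then obtain m m' n where "m \<in> carrier (env_algebra g)" "m' \<in> carrier (env_algebra g)"
    "r = pair (m \<oplus>\<^bsub>env_algebra g\<^esub> m') n - (pair m n + pair m' n)" by blast
  then show thesis using env_algebraE that(1) env_add by metis
next
  assume "r \<in> {pair m (n \<oplus>\<^bsub>scalar_space\<^esub> n') - (pair m n + pair m n') |m n n'.
        m \<in> carrier (env_algebra g) \<and> n \<in> carrier scalar_space \<and> n' \<in> carrier scalar_space}"
  then obtain m n n' where "m \<in> carrier (env_algebra g)"
    "r = pair m (n + n') - (pair m n + pair m n')" by auto
  then show thesis using env_algebraE that(2) by metis
next
  assume "r \<in> {pair (c \<odot>\<^bsub>env_algebra g\<^esub> m) n - Poly_Mapping.map ((*) c) (pair m n) |c m n.
        m \<in> carrier (env_algebra g) \<and> n \<in> carrier scalar_space}"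
  then obtain c m n where "m \<in> carrier (env_algebra g)"
    "r = pair (c \<odot>\<^bsub>env_algebra g\<^esub> m) n - Poly_Mapping.map ((*) c) (pair m n)" by blast
  then show thesis using env_algebraE that(3) env_smult by metis
next
  assume "r \<in> {pair m (c \<odot>\<^bsub>scalar_space\<^esub> n) - Poly_Mapping.map ((*) c) (pair m n) |c m n.
        m \<in> carrier (env_algebra g) \<and> n \<in> carrier scalar_space}"
  then obtain c m n where "m \<in> carrier (env_algebra g)"
    "r = pair m (c * n) - Poly_Mapping.map ((*) c) (pair m n)" by auto
  then show thesis using env_algebraE that(4) by metis
next
  assume "r \<in> {pair (m \<otimes>\<^bsub>env_algebra g\<^esub> env_incl g a) n - pair m (env_act scalar_space trivial_act a n) |m a n.
        m \<in> carrier (env_algebra g) \<and> a \<in> carrier (env_algebra (plus_subalgebra g)) \<and> n \<in> carrier scalar_space}"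
  then obtain m a n where r: "m \<in> carrier (env_algebra g)" "a \<in> carrier (env_algebra (plus_subalgebra g))"
    "r = pair (m \<otimes>\<^bsub>env_algebra g\<^esub> env_incl g a) n - pair m (env_act scalar_space trivial_act a n)" by blast
  obtain h where h: "h \<in> carrier (free_algebra g)" "m = coset h" using env_algebraE[OF r(1)] .
  obtain h' where h': "h' \<in> carrier (free_algebra (plus_subalgebra g))" "a = plus.coset h'"
    using plus.env_algebraE[OF r(2)] .
  show thesis
    using that(5)[OF h(1) h'(1), of n] r(3) h h'
    by (simp add: env_incl_coset env_act_trivial env_mult plus_free_closed)
qed

lemma pair_carrier: "h \<in> carrier (free_algebra g) \<Longrightarrow> pair (coset h) c \<in> carrier pairs"
  unfolding pair_def by (rule pairs.single_carrier) simp

lemma univ_generators_carrier: "univ_generators \<subseteq> carrier pairs"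
proof
  fix r assume "r \<in> univ_generators"
  then show "r \<in> carrier pairs"
    by (cases rule: univ_generators_cases) (auto simp: pair_carrier word_mult_closed plus_free_closed)
qed

lemma univ_relations_submodule: "submodule (univ_relations g) scalars pairs"
  unfolding univ_relations_span by (rule lin_span_submodule[OF pairs.vspace_axioms univ_generators_carrier])

lemma univ_generators_relations: "univ_generators \<subseteq> univ_relations g"
  unfolding univ_relations_span by (rule lin_span_superset)

lemma univ_space_simps:
  "carrier (univ_space g) = a_rcosets\<^bsub>pairs\<^esub> (univ_relations g)"
  "\<zero>\<^bsub>univ_space g\<^esub> = univ_relations g"
  "F \<in> carrier pairs \<Longrightarrow> G \<in> carrier pairs \<Longrightarrow> pcoset F \<oplus>\<^bsub>univ_space g\<^esub> pcoset G = pcoset (F + G)"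
  "F \<in> carrier pairs \<Longrightarrow> c \<odot>\<^bsub>univ_space g\<^esub> pcoset F = pcoset (Poly_Mapping.map ((*) c) F)"
  using pairs.coset_add[OF univ_relations_submodule, of F G]
    pairs.coset_smult[OF univ_relations_submodule, of F c]
  by (simp_all add: univ_space_def tensor_space_def quot_space_def univ_relations_def)

lemma pcoset_mem: "F \<in> carrier pairs \<Longrightarrow> pcoset F \<in> carrier (univ_space g)"
  by (auto simp: univ_space_simps A_RCOSETS_def')

lemma pcoset_eq:
  "F \<in> carrier pairs \<Longrightarrow> G \<in> carrier pairs \<Longrightarrow> F - G \<in> univ_generators \<Longrightarrow> pcoset F = pcoset G"
  using pairs.coset_eq_iff[OF univ_relations_submodule] univ_generators_relations by auto

lemma pcoset_pair:
  assumes h: "h \<in> carrier (free_algebra g)"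
  shows "pcoset (pair (coset h) c) = c \<odot>\<^bsub>univ_space g\<^esub> pcoset (pair (coset h) 1)"
proof -
  have "pair (coset h) (c * 1) - Poly_Mapping.map ((*) c) (pair (coset h) 1) \<in> univ_generators"
    by (rule univ_generatorsI(3)[OF coset_carrier[OF h]])
  then show ?thesis using h
    by (simp add: univ_space_simps pair_carrier) (intro pcoset_eq, simp_all add: pair_carrier)
qed

lemma pcoset_scale:
  assumes h: "h \<in> carrier (free_algebra g)"
  shows "pcoset (pair (coset (Poly_Mapping.map ((*) c) h)) 1) = c \<odot>\<^bsub>univ_space g\<^esub> pcoset (pair (coset h) 1)"
proof -
  have "pair (c \<odot>\<^bsub>env_algebra g\<^esub> coset h) 1 - Poly_Mapping.map ((*) c) (pair (coset h) 1) \<in> univ_generators"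
    by (rule univ_generatorsI(2)[OF coset_carrier[OF h]])
  then show ?thesis using h
    by (simp add: univ_space_simps pair_carrier env_smult) (intro pcoset_eq, simp_all add: pair_carrier)
qed

lemma pcoset_add:
  assumes h: "h \<in> carrier (free_algebra g)" and h': "h' \<in> carrier (free_algebra g)"
  shows "pcoset (pair (coset (h + h')) 1) = pcoset (pair (coset h) 1) \<oplus>\<^bsub>univ_space g\<^esub> pcoset (pair (coset h') 1)"
proof -
  have "pair (coset h \<oplus>\<^bsub>env_algebra g\<^esub> coset h') 1 - (pair (coset h) 1 + pair (coset h') 1) \<in> univ_generators"
    unfolding univ_generators_def using coset_carrier[OF h] coset_carrier[OF h'] by auto
  then show ?thesis using h h'
    by (simp add: univ_space_simps pair_carrier env_add) (intro pcoset_eq, simp_all add: pair_carrier)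
qed

text \<open>The class of \<open>w \<otimes> 1\<close>, that is, the letters of \<open>w\<close>
  applied to the identity of \<open>V(g)\<close>.\<close>

definition word_vec where
  "word_vec w = pcoset (pair (coset (Poly_Mapping.single w 1)) 1)"

lemma univ_one_word: "univ_one g = word_vec []"
  by (simp add: univ_one_def word_vec_def env_algebra_simps)

lemma word_vec_mem: "w \<in> lists (carrier g) \<Longrightarrow> word_vec w \<in> carrier (univ_space g)"
  unfolding word_vec_def by (intro pcoset_mem pair_carrier free.single_carrier)

text \<open>\<open>univ_act\<close> is a union over representatives, and the representative
  \<open>w \<otimes> 1\<close> contributes the coset \<open>word_vec (x # w)\<close>. By
  \<open>closed\<close> the union is itself a coset, so it must be this one.\<close>

lemma univ_act_word:
  assumes w: "w \<in> lists (carrier g)" and x: "x \<in> carrier g"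
    and closed: "univ_act g x (word_vec w) \<in> carrier (univ_space g)"
  shows "univ_act g x (word_vec w) = word_vec (x # w)"
proof -
  let ?D = "coset (Poly_Mapping.single w 1)"
  have wc: "Poly_Mapping.single w 1 \<in> carrier (free_algebra g)" "Poly_Mapping.single (x # w) 1 \<in> carrier (free_algebra g)"
    using w x by simp_all
  have "env_embed g x \<otimes>\<^bsub>env_algebra g\<^esub> ?D = coset (Poly_Mapping.single (x # w) 1)"
    using x wc by (simp add: env_embed_def env_mult letter_carrier) (simp add: letter_def)
  then have "word_vec (x # w) = pcoset (\<Sum>(u, c)\<in>Poly_Mapping.keys (pair ?D 1).
        Poly_Mapping.single (env_embed g x \<otimes>\<^bsub>env_algebra g\<^esub> u, c) (Poly_Mapping.lookup (pair ?D 1) (u, c)))"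
    by (simp add: word_vec_def pair_def)
  moreover have "pair ?D 1 \<in> word_vec w"
    unfolding word_vec_def by (rule pairs.coset_self[OF univ_relations_submodule pair_carrier[OF wc(1)]])
  ultimately have sub: "word_vec (x # w) \<subseteq> univ_act g x (word_vec w)"
    unfolding univ_act_def by blast
  obtain G where G: "G \<in> carrier pairs" "univ_act g x (word_vec w) = pcoset G"
    using closed unfolding univ_space_simps by (rule a_rcosetsE)
  show ?thesis
    using pairs.coset_mono_eq[OF univ_relations_submodule pair_carrier[OF wc(2)] G(1)] sub
    unfolding G(2) unfolding word_vec_def by blast
qed

text \<open>Combinations of words reach every \<open>u \<otimes> 1\<close>, by linearity in the
  first factor. Then \<open>u \<otimes> c = c (u \<otimes> 1)\<close> reaches all pure tensors, and
  these span.\<close>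

lemma univ_space_spanned:
  assumes S: "univ_relations g \<in> S"
    "\<And>x y. x \<in> S \<Longrightarrow> y \<in> S \<Longrightarrow> x \<oplus>\<^bsub>univ_space g\<^esub> y \<in> S" "\<And>c x. x \<in> S \<Longrightarrow> c \<odot>\<^bsub>univ_space g\<^esub> x \<in> S"
    and word: "\<And>w. w \<in> lists (carrier g) \<Longrightarrow> word_vec w \<in> S"
  shows "carrier (univ_space g) \<subseteq> S"
proof
  have one: "pcoset (pair (coset h) 1) \<in> S" if "h \<in> carrier (free_algebra g)" for h
    using that
  proof (induction h rule: free.carrier_induct)
    case zero
    have "pcoset (pair (coset 0) 1) = 0 \<odot>\<^bsub>univ_space g\<^esub> word_vec []"
      using pcoset_scale[of "Poly_Mapping.single [] 1" 0] by (simp add: word_vec_def scale_single)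
    then show ?case using S word by simp
  next
    case (single u c)
    then have "pcoset (pair (coset (Poly_Mapping.single u c)) 1) = c \<odot>\<^bsub>univ_space g\<^esub> word_vec u"
      using pcoset_scale[of "Poly_Mapping.single u 1" c] by (simp add: word_vec_def scale_single)
    then show ?case using S word single by simp
  next
    case (add p q)
    then show ?case using S by (simp add: pcoset_add)
  qed
  fix x assume "x \<in> carrier (univ_space g)"
  then obtain F where F: "F \<in> carrier pairs" "x = pcoset F"
    unfolding univ_space_simps by (rule a_rcosetsE)
  have "pcoset F \<in> S" using F(1)
  proof (induction F rule: pairs.carrier_induct)
    case zero
    show ?case using S(1) pairs.coset_zero[OF univ_relations_submodule] by simp
  next
    case (single u k)
    then obtain h c where h: "h \<in> carrier (free_algebra g)" "u = (coset h, c)"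
      using env_algebraE by (metis SigmaE)
    then have "Poly_Mapping.single u k = Poly_Mapping.map ((*) k) (pair (coset h) c)"
      by (simp add: pair_def scale_single)
    then have "pcoset (Poly_Mapping.single u k) = k \<odot>\<^bsub>univ_space g\<^esub> (c \<odot>\<^bsub>univ_space g\<^esub> pcoset (pair (coset h) 1))"
      using univ_space_simps(4)[OF pair_carrier[OF h(1)]] pcoset_pair[OF h(1), of c] by metis
    then show ?case using S(3) one[OF h(1)] by simp
  next
    case (add p q)
    then show ?case using S(2) by (metis univ_space_simps(3))
  qed
  then show "x \<in> S" using F by simp
qed

end

text \<open>Skew-symmetry reduces these products to those with \<one> on the left, which
  vanish.\<close>

lemma (in unital_vertex_algebra) assoc_nprod_one_right:
  assumes "associative_vertex_algebra V" "a \<in> carrier V"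
  shows "nprod V n a \<one> = \<zero>"
proof -
  interpret A: associative_vertex_algebra V by fact
  have "nprod V n a \<one> = \<zero>" if a: "a \<in> grade V p" for a p
  proof -
    have "{j. nprod V (n + j) \<one> a \<noteq> \<zero>} = {}" using a by (simp add: nprod_one_left)
    then show ?thesis unfolding A.lambda_skew[OF a one_grade] by simp
  qed
  moreover have "linmap V V (\<lambda>x. \<zero>)" by unfold_locales (simp add: linear_map_def)
  ultimately show ?thesis
    by (rule linear_map_ext[OF nprod_left[OF one_carrier] _ superspace_axioms _ assms(2), rotated])
qed

section \<open>The linear map from \<open>V(g)\<close> to a vertex algebra \<open>W\<close> over
  \<open>g\<close>\<close>

context
  fixes g :: "('k::field_char_0, 'g, 'l) local_lie_algebra_scheme"
    and W :: "('k, 'w, 'g, 'n) vertex_algebra_over_scheme"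
  assumes g: "local_lie_algebra g" and W: "assoc_unital_vertex_algebra_over g W"
begin

interpretation g: local_lie_algebra g by (rule g)

interpretation W: unital_vertex_algebra W
  using W by (simp add: assoc_unital_vertex_algebra_over_def)

interpretation pairs: finsupp_space g.pairs "carrier (env_algebra g) \<times> UNIV"
  using pair_space_finsupp[of "env_algebra g" scalar_space] by simp

lemma W_lie_action: "lie_action g W (act W)"
  using W by (simp add: assoc_unital_vertex_algebra_over_def vertex_algebra_over_def)

interpretation wact: word_action g W "act W"
  by unfold_locales (rule W_lie_action)

text \<open>A generating field acts as some \<open>Y(u)\<close>, whose nonnegative modes kill
  \<one>. As \<one> is even, \<open>plus_annihilates\<close> extends this to the whole
  subalgebra.\<close>

lemma plus_act_one: "x \<in> plus_carrier g \<Longrightarrow> act W x \<one>\<^bsub>W\<^esub> = \<zero>\<^bsub>W\<^esub>"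
proof (rule g.plus_annihilates[OF W_lie_action W.superspace_axioms W.one_grade])
  fix a and t :: int assume a: "a \<in> gen_fields g" and t: "t \<ge> 0"
  have "associative_vertex_algebra W" using W by (simp add: assoc_unital_vertex_algebra_over_def)
  then show "act W (a t) \<one>\<^bsub>W\<^esub> = \<zero>\<^bsub>W\<^esub>"
    using t W.assoc_nprod_one_right gen_field_act(1)[OF W a]
    by (simp add: gen_field_act(2)[OF W a W.one_carrier, of t] mode_def)
qed

text \<open>On \<one> the subalgebra acts through the augmentation, as on the trivial module. This
  is what sends the balancing relations to zero.\<close>

lemma plus_word_act_one:
  assumes "h \<in> carrier (free_algebra (plus_subalgebra g))"
  shows "wact.word_act h \<one>\<^bsub>W\<^esub> = Poly_Mapping.lookup h [] \<odot>\<^bsub>W\<^esub> \<one>\<^bsub>W\<^esub>"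
  using assms
proof (induction h rule: free.carrier_induct)
  case (single u k)
  then have u: "u \<in> lists (plus_carrier g)" "u \<in> lists (carrier g)"
    using g.plus_carrier_closed by auto
  have "foldr (act W) u \<one>\<^bsub>W\<^esub> = (if u = [] then \<one>\<^bsub>W\<^esub> else \<zero>\<^bsub>W\<^esub>)"
    using u(1)
  proof (induction u)
    case (Cons x u)
    then show ?case
      using plus_act_one linmap.zero[OF wact.action_linmap] g.plus_carrier_closed by auto
  qed simp
  then show ?case using u(2) W.one_carrier by (simp add: wact.word_act_single lookup_single)
next
  case (add p q)
  then show ?case
    using W.one_carrier g.plus_free_closed by (simp add: wact.word_act_add lookup_add W.sm_add_left)
qed (use W.one_carrier in simp)

text \<open>The map \<open>u \<mapsto> u \<one>\<close> on \<open>U(g)\<close>, computed from an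
  arbitrary representative.\<close>

definition env_vec where "env_vec D = wact.word_act (SOME h. h \<in> D) \<one>\<^bsub>W\<^esub>"

lemma env_vec_coset:
  assumes h: "h \<in> carrier (free_algebra g)"
  shows "env_vec (g.coset h) = wact.word_act h \<one>\<^bsub>W\<^esub>"
  unfolding env_vec_def
  by (rule wact.coset_act_eq[OF h someI W.one_carrier]) (rule free.coset_self[OF g.env_submodule h])

text \<open>The map \<open>u \<otimes> c \<mapsto> c (u \<one>)\<close> before passing to the
  quotient by the relations.\<close>

definition pair_map where "pair_map = lin_extension W (\<lambda>(D, c). c \<odot>\<^bsub>W\<^esub> env_vec D)"

lemma env_vec_closed: "D \<in> carrier (env_algebra g) \<Longrightarrow> env_vec D \<in> carrier W"
  using g.env_algebraE env_vec_coset wact.word_act_closed W.one_carrier by metis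

lemma pair_map_linmap: "linmap g.pairs W pair_map"
  unfolding pair_map_def
  by (rule pairs.lin_extension_linmap[OF W.vspace_axioms]) (auto simp: env_vec_closed)

lemma pair_map_pair:
  assumes h: "h \<in> carrier (free_algebra g)"
  shows "pair_map (pair (g.coset h) c) = c \<odot>\<^bsub>W\<^esub> wact.word_act h \<one>\<^bsub>W\<^esub>"
  unfolding pair_map_def pair_def
  using lin_extension_single[OF W.vspace_axioms, of "\<lambda>(D, c). c \<odot>\<^bsub>W\<^esub> env_vec D" "(g.coset h, c)" 1]
    h W.one_carrier by (simp add: env_vec_coset)

lemma pair_map_relations:
  assumes "r \<in> univ_relations g" shows "pair_map r = \<zero>\<^bsub>W\<^esub>"
proof -
  interpret p: linmap g.pairs W pair_map by (rule pair_map_linmap)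
  have "pair_map r = \<zero>\<^bsub>W\<^esub>" if "r \<in> g.univ_generators" for r
    using that W.one_carrier
    by (cases rule: g.univ_generators_cases)
      (use p.minus p.add p.sm in \<open>simp_all add: g.pair_carrier pair_map_pair word_mult_closed g.plus_free_closed
        wact.word_act_add wact.word_act_scale wact.word_act_mult plus_word_act_one
        linmap.sm[OF wact.word_act_linmap_right] W.sm_add_left W.sm_add_right W.sm_assoc W.minus_eq_zero_iff
        mult.commute\<close>)
  moreover have "submodule {r \<in> carrier g.pairs. pair_map r = \<zero>\<^bsub>W\<^esub>} scalars g.pairs"
    by (rule pairs.subspaceI) (use p.add p.sm p.zero in \<open>auto\<close>)
  ultimately have "univ_relations g \<subseteq> {r \<in> carrier g.pairs. pair_map r = \<zero>\<^bsub>W\<^esub>}"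
    unfolding g.univ_relations_span using g.univ_generators_carrier by (intro lin_span_induct) auto
  then show ?thesis using assms by blast
qed

definition univ_map where "univ_map C = pair_map (SOME F. F \<in> C)"

lemma univ_map_pcoset: "F \<in> carrier g.pairs \<Longrightarrow> univ_map (g.pcoset F) = pair_map F"
  unfolding univ_map_def
  using linmap.some_coset_rep[OF pair_map_linmap g.univ_relations_submodule pair_map_relations] by simp

lemma univ_map_word:
  assumes "w \<in> lists (carrier g)" shows "univ_map (g.word_vec w) = foldr (act W) w \<one>\<^bsub>W\<^esub>"
  using assms W.one_carrier unfolding g.word_vec_def
  by (simp add: univ_map_pcoset g.pair_carrier pair_map_pair wact.word_act_single)

lemma univ_map_linear: "linear_map (univ_space g) W univ_map"
  unfolding linear_map_def
proof (intro conjI ballI allI)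
  interpret p: linmap g.pairs W pair_map by (rule pair_map_linmap)
  have ex: "\<exists>F\<in>carrier g.pairs. C = g.pcoset F" if "C \<in> carrier (univ_space g)" for C
    using that unfolding g.univ_space_simps by (blast elim: a_rcosetsE)
  show "univ_map \<in> carrier (univ_space g) \<rightarrow> carrier W"
    using ex univ_map_pcoset by fastforce
  fix x assume "x \<in> carrier (univ_space g)"
  then obtain F where F: "F \<in> carrier g.pairs" "x = g.pcoset F" using ex by blast
  show "univ_map (c \<odot>\<^bsub>univ_space g\<^esub> x) = c \<odot>\<^bsub>W\<^esub> univ_map x" for c
    using F p.sm[of F c] by (simp add: univ_map_pcoset g.univ_space_simps)
  fix y assume "y \<in> carrier (univ_space g)"
  then obtain G where G: "G \<in> carrier g.pairs" "y = g.pcoset G" using ex by blast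
  show "univ_map (x \<oplus>\<^bsub>univ_space g\<^esub> y) = univ_map x \<oplus>\<^bsub>W\<^esub> univ_map y"
    using F G p.add[of F G] by (simp add: univ_map_pcoset g.univ_space_simps)
qed

end

section \<open>Existence and uniqueness of the morphism\<close>

context
  fixes g :: "('k::field_char_0, 'g) local_lie_algebra"
    and V :: "('k, ('k, 'g) univ, 'g) vertex_algebra_over"
  assumes g: "local_lie_algebra g" and V: "is_universal_vertex_algebra g V"
begin

interpretation g: local_lie_algebra g by (rule g)

interpretation V: unital_vertex_algebra V
  using V by (simp add: is_universal_vertex_algebra_def assoc_unital_vertex_algebra_over_def)

lemma universal_simps:
  "carrier V = carrier (univ_space g)" "\<zero>\<^bsub>V\<^esub> = univ_relations g" "add V = add (univ_space g)"
  "module.smult V = module.smult (univ_space g)" "act V = univ_act g" "\<one>\<^bsub>V\<^esub> = g.word_vec []"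
  "lie_action g V (act V)"
  using V by (auto simp: is_universal_vertex_algebra_def g.univ_one_word g.univ_space_simps
      assoc_unital_vertex_algebra_over_def vertex_algebra_over_def)

text \<open>Since \<open>V\<close> is a \<open>g\<close>-module, the action stays in the carrier.
  Its value is therefore a single coset, as \<open>univ_act_word\<close> requires.\<close>

lemma universal_act_word:
  assumes "w \<in> lists (carrier g)" "x \<in> carrier g"
  shows "act V x (g.word_vec w) = g.word_vec (x # w)"
  unfolding universal_simps(5)
proof (rule g.univ_act_word[OF assms])
  show "univ_act g x (g.word_vec w) \<in> carrier (univ_space g)"
    using linmap.closed[OF g.lie_action_linmaps(1)[OF universal_simps(7) V.superspace_axioms assms(2)]]
      g.word_vec_mem[OF assms(1)] by (simp add: universal_simps)
qed

lemma universal_spanned: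
  assumes S: "submodule S scalars V" and word: "\<And>w. w \<in> lists (carrier g) \<Longrightarrow> g.word_vec w \<in> S"
  shows "carrier V \<subseteq> S"
  unfolding universal_simps
  by (rule g.univ_space_spanned) (use V.subspaceD[OF S] word in \<open>auto simp: universal_simps\<close>)

text \<open>Each \<open>word_vec w\<close> arises from \<one> by applying the letters of
  \<open>w\<close> one by one. This supplies the assumption \<open>generated\<close> of
  \<open>equivariant_map\<close>.\<close>

lemma universal_generated:
  assumes S: "submodule S scalars V" and one: "\<one>\<^bsub>V\<^esub> \<in> S"
    and act: "\<And>x v. x \<in> carrier g \<Longrightarrow> v \<in> S \<Longrightarrow> act V x v \<in> S"
  shows "carrier V \<subseteq> S"
proof (rule universal_spanned[OF S])
  fix w assume "w \<in> lists (carrier g)"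
  then show "g.word_vec w \<in> S"
  proof (induction w)
    case (Cons x w)
    then show ?case using act[of x "g.word_vec w"] universal_act_word[of w x] by auto
  qed (use one in \<open>simp add: universal_simps\<close>)
qed

lemma universal_morphism_exists:
  fixes W :: "('k, 'w, 'g, 'n) vertex_algebra_over_scheme"
  assumes W: "assoc_unital_vertex_algebra_over g W"
  shows "\<exists>f. unital_vertex_algebra_over_morphism g V W f"
proof -
  interpret W: unital_vertex_algebra W
    using W by (simp add: assoc_unital_vertex_algebra_over_def)
  let ?f = "univ_map W"
  note Wact = g.lie_action_linmaps[OF W_lie_action[OF g W] W.superspace_axioms]
  note Vact = g.lie_action_linmaps[OF universal_simps(7) V.superspace_axioms]
  note word = univ_map_word[OF g W]
  have lin: "linear_map V W ?f"
    using univ_map_linear[OF g W] by (simp add: linear_map_def universal_simps)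
  then interpret f: linmap V W ?f by unfold_locales
  have act: "?f (act V x v) = act W x (?f v)" if x: "x \<in> carrier g" and v: "v \<in> carrier V" for x v
  proof -
    interpret x: linmap V V "act V x" by (rule Vact(1)[OF x])
    interpret y: linmap W W "act W x" by (rule Wact(1)[OF x])
    \<comment> \<open>Both sides are linear in \<open>v\<close>, so word vectors suffice; there both
      equal \<open>foldr (act W) (x # w) \<one>\<close>.\<close>
    have "submodule {v \<in> carrier V. ?f (act V x v) = act W x (?f v)} scalars V"
      by (rule V.subspaceI) (auto simp: x.add y.add f.add x.sm y.sm f.sm)
    then have "carrier V \<subseteq> {v \<in> carrier V. ?f (act V x v) = act W x (?f v)}"
    proof (rule universal_spanned)
      fix w assume w: "w \<in> lists (carrier g)"
      then show "g.word_vec w \<in> {v \<in> carrier V. ?f (act V x v) = act W x (?f v)}"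
        using x g.word_vec_mem[OF w] by (simp add: universal_act_word word universal_simps(1))
    qed
    then show ?thesis using v by blast
  qed
  have "equivariant_map g V W ?f"
  proof (intro equivariant_map.intro equivariant_map_axioms.intro)
    show "?f \<one>\<^bsub>V\<^esub> = \<one>\<^bsub>W\<^esub>" using word[of "[]"] by (simp add: universal_simps)
  qed (use V W g act universal_generated V.unital_vertex_algebra_axioms W.unital_vertex_algebra_axioms f.linmap_axioms
      in \<open>auto simp: is_universal_vertex_algebra_def assoc_unital_vertex_algebra_over_def\<close>)
  then show ?thesis using equivariant_map.restrict_morphism by blast
qed

text \<open>The equaliser of two morphisms is a \<open>g\<close>-submodule containing \<one>, hence
  all of \<open>V\<close>; extensionality turns agreement on the carrier into equality of
  functions.\<close>

lemma universal_morphism_unique: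
  fixes W :: "('k, 'w, 'g, 'n) vertex_algebra_over_scheme"
  assumes W: "superspace W"
    and f: "unital_vertex_algebra_over_morphism g V W f" and h: "unital_vertex_algebra_over_morphism g V W h"
  shows "f = h"
proof -
  note defs = unital_vertex_algebra_over_morphism_def unital_vertex_algebra_morphism_def even_linear_def
  interpret f: linmap V W f
    using f by (intro superspace_linmapI V.superspace_axioms W) (simp add: defs)
  interpret h: linmap V W h
    using h by (intro superspace_linmapI V.superspace_axioms W) (simp add: defs)
  have "submodule {v \<in> carrier V. f v = h v} scalars V"
    by (rule V.subspaceI) (auto simp: f.add h.add f.sm h.sm)
  then have "carrier V \<subseteq> {v \<in> carrier V. f v = h v}"
  proof (rule universal_generated)
    show "\<one>\<^bsub>V\<^esub> \<in> {v \<in> carrier V. f v = h v}" using f h V.one_carrier by (simp add: defs)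
    fix x v assume "x \<in> carrier g" "v \<in> {v \<in> carrier V. f v = h v}"
    then show "act V x v \<in> {v \<in> carrier V. f v = h v}"
      using f h linmap.closed[OF g.lie_action_linmaps(1)[OF universal_simps(7) V.superspace_axioms]]
      by (simp add: defs)
  qed
  moreover have "f \<in> extensional (carrier V)" "h \<in> extensional (carrier V)"
    using f h by (simp_all add: defs)
  ultimately show ?thesis by (intro extensionalityI[of f "carrier V" h]) auto
qed

end

theorem proposition5p2p3:
  fixes g :: "('k::field_char_0, 'g) local_lie_algebra"
    and V :: "('k, ('k, 'g) univ, 'g) vertex_algebra_over"
  assumes "local_lie_algebra g"
    and "is_universal_vertex_algebra g V"
  shows "assoc_unital_vertex_algebra_over g V \<and>
    (\<forall>W :: ('k, 'w, 'g) vertex_algebra_over.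
      assoc_unital_vertex_algebra_over g W \<longrightarrow>
      (\<exists>!f. unital_vertex_algebra_over_morphism g V W f))"
proof (intro conjI allI impI)
  show "assoc_unital_vertex_algebra_over g V"
    using assms(2) by (simp add: is_universal_vertex_algebra_def)
  fix W :: "('k, 'w, 'g) vertex_algebra_over"
  assume W: "assoc_unital_vertex_algebra_over g W"
  then have "superspace W"
    unfolding assoc_unital_vertex_algebra_over_def unital_vertex_algebra_def vertex_algebra_def
      superalgebra_def by blast
  then show "\<exists>!f. unital_vertex_algebra_over_morphism g V W f"
    using universal_morphism_exists[OF assms W] universal_morphism_unique[OF assms] by blast
qed

end
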